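(* Let $m>1$, $0\le u_0\in L^1(\mathbb{R}^N)$, let $-\mathfrak{L}$ be an operator as in the context for which the Green function assumption holds with $A=-\mathfrak{L}$, and let $u$ be a weak dual solution of $\partial_t u+(-\mathfrak{L})[u^m]=0$ with initial data $u_0$. If there is a constant $C_1>0$ with $$\|\mathbb{G}_{-\mathfrak{L}}^{x_0}\|_{L^1(\mathbb{R}^N)}=\|\mathbb{G}_{-\mathfrak{L}}^{0}\|_{L^1(\mathbb{R}^N)}\le C_1<\infty,$$ then $$\|u(\cdot,t)\|_{L^\infty(\mathbb{R}^N)}\le\tilde C(m)\,t^{-1/(m-1)}\qquad\text{for a.e. }t>0,$$ where $\tilde C(m):=\big(2^{\frac{m}{m-1}}C_1\big)^{1/(m-1)}$.
   Context: Throughout $N\ge 3$. Operator. $-\mathfrak{L}$ is a linear, symmetric, nonnegative operator which is densely defined, $\mathfrak m$-accretive and Dirichlet in $L^1(\mathbb{R}^N)$: writing $A=-\mathfrak{L}$ with domain $D(A)\subset L^1(\mathbb{R}^N)$, $D(A)$ is dense in $L^1$; $\|u\|_{L^1}\le\|u+\lambda A[u]\|_{L^1}$ for all $u\in D(A)$, $\lambda>0$; the range of $I+\lambda A$ is $L^1(\mathbb{R}^N)$ for all $\lambda>0$; and if $f\in L^1$, $a\le f\le b$ a.e. ($a,b\in\mathbb{R}$), then $a\le(I+\lambda A)^{-1}f\le b$ a.e. Green function assumption for an operator $A$: there is a function $\mathbb{G}_A^{x_0}\in L^1_{\rm loc}(\mathbb{R}^N)$ (for each $x_0$) with $0\le\mathbb{G}_A^{x_0}=\mathbb{G}_A^0(\cdot-x_0)=\mathbb{G}_A^0(x_0-\cdot)$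 a.e. and $A[\mathbb{G}_A^{x_0}]=\delta_{x_0}$ in $\mathcal D'(\mathbb{R}^N)$. Then $A^{-1}[f](y):=\int_{\mathbb{R}^N}\mathbb{G}_A^0(x-y)f(x)\,dx$ whenever the integral converges. Weak dual solution of $\partial_tu+(-\mathfrak{L})[u^m]=0$ in $\mathbb{R}^N\times(0,T)$, $u(\cdot,0)=u_0$: a nonnegative measurable $u$ such that (i) $u\in C([0,T];L^1(\mathbb{R}^N))$ and $u^m\in L^1((0,T);L^1_{\rm loc}(\mathbb{R}^N))$; (ii) for a.e. $0<\tau_1\le\tau_2\le T$ and all $\psi\in C^1_{\rm c}([\tau_1,\tau_2];L^\infty_{\rm c}(\mathbb{R}^N))$ (here $L_{\rm c}^\infty$ denotes bounded functions with compact support), $$\int_{\tau_1}^{\tau_2}\!\!\int_{\mathbb{R}^N}\big((-\mathfrak{L})^{-1}[u]\partial_t\psi-u^m\psi\big)dx\,dt=\int_{\mathbb{R}^N}(-\mathfrak{L})^{-1}[u(\cdot,\tau_2)]\psi(\cdot,\tau_2)dx-\int_{\mathbb{R}^N}(-\mathfrak{L})^{-1}[u(\cdot,\tau_1)]\psi(\cdot,\tau_1)dx;$$ (iii) $u(\cdot,0)=u_0$ a.e. Here $u$ is a weak dual solution for every $T>0$. Standing assumption: the comparison principle ($u_0\le v_0$ a.e. implies $u\le v$ a.e.) and $L^p$-decay ($\|u(\cdot,\tau_2)\|_{L^p}\le\|u(\cdot,\tau_1)\|_{L^p}$ for $p\in[1,\infty]$ and a.e. $0\le\tau_1\le\tau_2$)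 hold for solutions of the equation. *)

theory Defs
  imports "HOL-Analysis.Analysis" "HOL-Probability.Essential_Supremum"
begin

text \<open>
  All function spaces are taken with respect to (complete) Lebesgue measure. Elements of
  \<open>L\<^sup>p\<close> are represented by functions; identities between them are required almost
  everywhere only.
\<close>

section \<open>Function spaces\<close>

definition Lp_norm :: "ennreal \<Rightarrow> ('a::euclidean_space \<Rightarrow> real) \<Rightarrow> ennreal" where
  "Lp_norm p f =
    (if p = \<infinity> then esssup lebesgue (\<lambda>x. ennreal \<bar>f x\<bar>)
     else (let I = \<integral>\<^sup>+x. ennreal (\<bar>f x\<bar> powr enn2real p) \<partial>lebesgue
           in if I = \<infinity> then \<infinity> else ennreal (enn2real I powr (1 / enn2real p))))"

lemma Lp_norm_1: "Lp_norm 1 f = (\<integral>\<^sup>+x. ennreal \<bar>f x\<bar> \<partial>lebesgue)"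
  by (simp add: Lp_norm_def Let_def less_top)

definition in_Lp :: "ennreal \<Rightarrow> ('a::euclidean_space \<Rightarrow> real) \<Rightarrow> bool" where
  "in_Lp p f \<longleftrightarrow> f \<in> borel_measurable lebesgue \<and> Lp_norm p f < \<infinity>"

lemma in_L1_iff_integrable: "in_Lp 1 f \<longleftrightarrow> integrable lebesgue f"
  by (auto simp: in_Lp_def Lp_norm_1 integrable_iff_bounded)

definition L1_loc :: "('a::euclidean_space \<Rightarrow> real) \<Rightarrow> bool" where
  "L1_loc f \<longleftrightarrow> (\<forall>K. compact K \<longrightarrow> set_integrable lebesgue K f)"

primrec Ck :: "nat \<Rightarrow> ('a::euclidean_space \<Rightarrow> real) \<Rightarrow> bool" where
  "Ck 0 f \<longleftrightarrow> continuous_on UNIV f"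
| "Ck (Suc k) f \<longleftrightarrow> f differentiable_on UNIV \<and>
     (\<forall>b\<in>Basis. Ck k (\<lambda>x. frechet_derivative f (at x) b))"

definition test_function :: "('a::euclidean_space \<Rightarrow> real) \<Rightarrow> bool" where
  "test_function \<phi> \<longleftrightarrow> (\<forall>k. Ck k \<phi>) \<and> compact (closure {x. \<phi> x \<noteq> 0})"


section \<open>The operator\<close>

text \<open>
  An operator in \<open>L\<^sup>1\<close> is a domain \<open>D\<close> together with a map \<open>A\<close>, of which only the values
  on \<open>D\<close> matter. Both have to respect equality almost everywhere.
\<close>

definition L1_operator ::
  "('a::euclidean_space \<Rightarrow> real) set \<Rightarrow> (('a \<Rightarrow> real) \<Rightarrow> ('a \<Rightarrow> real)) \<Rightarrow> bool" where
  "L1_operator D A \<longleftrightarrow>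
     (\<forall>f\<in>D. integrable lebesgue f \<and> integrable lebesgue (A f)) \<and>
     (\<forall>f\<in>D. \<forall>g\<in>borel_measurable lebesgue. (AE x in lebesgue. f x = g x) \<longrightarrow>
        g \<in> D \<and> (AE x in lebesgue. A f x = A g x))"

definition linear_operator ::
  "('a::euclidean_space \<Rightarrow> real) set \<Rightarrow> (('a \<Rightarrow> real) \<Rightarrow> ('a \<Rightarrow> real)) \<Rightarrow> bool" where
  "linear_operator D A \<longleftrightarrow>
     (\<lambda>x. 0) \<in> D \<and>
     (\<forall>f\<in>D. \<forall>g\<in>D. (\<lambda>x. f x + g x) \<in> D \<and>
        (AE x in lebesgue. A (\<lambda>x. f x + g x) x = A f x + A g x)) \<and>
     (\<forall>f\<in>D. \<forall>c. (\<lambda>x. c * f x) \<in> D \<and>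
        (AE x in lebesgue. A (\<lambda>x. c * f x) x = c * A f x))"

text \<open>
  Symmetry and nonnegativity refer to the \<open>L\<^sup>2\<close> inner product, hence to the part of \<open>A\<close>
  in \<open>L\<^sup>2\<close>.
\<close>

definition L2_part ::
  "('a::euclidean_space \<Rightarrow> real) set \<Rightarrow> (('a \<Rightarrow> real) \<Rightarrow> ('a \<Rightarrow> real)) \<Rightarrow> ('a \<Rightarrow> real) set" where
  "L2_part D A = {f\<in>D. in_Lp 2 f \<and> in_Lp 2 (A f)}"

definition symmetric_operator ::
  "('a::euclidean_space \<Rightarrow> real) set \<Rightarrow> (('a \<Rightarrow> real) \<Rightarrow> ('a \<Rightarrow> real)) \<Rightarrow> bool" where
  "symmetric_operator D A \<longleftrightarrow>
     (\<forall>f\<in>L2_part D A. \<forall>g\<in>L2_part D A.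
        (LINT x|lebesgue. A f x * g x) = (LINT x|lebesgue. f x * A g x))"

definition nonnegative_operator ::
  "('a::euclidean_space \<Rightarrow> real) set \<Rightarrow> (('a \<Rightarrow> real) \<Rightarrow> ('a \<Rightarrow> real)) \<Rightarrow> bool" where
  "nonnegative_operator D A \<longleftrightarrow>
     (\<forall>f\<in>L2_part D A. (LINT x|lebesgue. A f x * f x) \<ge> 0)"

definition densely_defined :: "('a::euclidean_space \<Rightarrow> real) set \<Rightarrow> bool" where
  "densely_defined D \<longleftrightarrow>
     (\<forall>f. integrable lebesgue f \<longrightarrow>
        (\<forall>\<epsilon>>0. \<exists>g\<in>D. Lp_norm 1 (\<lambda>x. f x - g x) < ennreal \<epsilon>))"

definition m_accretive ::
  "('a::euclidean_space \<Rightarrow> real) set \<Rightarrow> (('a \<Rightarrow> real) \<Rightarrow> ('a \<Rightarrow> real)) \<Rightarrow> bool" where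
  "m_accretive D A \<longleftrightarrow>
     (\<forall>f\<in>D. \<forall>\<mu>>0. Lp_norm 1 f \<le> Lp_norm 1 (\<lambda>x. f x + \<mu> * A f x)) \<and>
     (\<forall>\<mu>>0. \<forall>f. integrable lebesgue f \<longrightarrow>
        (\<exists>g\<in>D. AE x in lebesgue. g x + \<mu> * A g x = f x))"

text \<open>In the next definition \<open>g = (I + \<mu> A)\<^sup>-\<^sup>1 f\<close>.\<close>

definition Dirichlet_operator ::
  "('a::euclidean_space \<Rightarrow> real) set \<Rightarrow> (('a \<Rightarrow> real) \<Rightarrow> ('a \<Rightarrow> real)) \<Rightarrow> bool" where
  "Dirichlet_operator D A \<longleftrightarrow>
     (\<forall>\<mu>>0. \<forall>f. \<forall>g\<in>D. \<forall>a b::real.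
        integrable lebesgue f \<longrightarrow>
        (AE x in lebesgue. a \<le> f x \<and> f x \<le> b) \<longrightarrow>
        (AE x in lebesgue. g x + \<mu> * A g x = f x) \<longrightarrow>
        (AE x in lebesgue. a \<le> g x \<and> g x \<le> b))"

definition admissible_operator ::
  "('a::euclidean_space \<Rightarrow> real) set \<Rightarrow> (('a \<Rightarrow> real) \<Rightarrow> ('a \<Rightarrow> real)) \<Rightarrow> bool" where
  "admissible_operator D A \<longleftrightarrow>
     L1_operator D A \<and> linear_operator D A \<and> symmetric_operator D A \<and>
     nonnegative_operator D A \<and> densely_defined D \<and> m_accretive D A \<and> Dirichlet_operator D A"


section \<open>Green functions\<close>

text \<open>
  \<open>G x0\<close> is the Green function with pole \<open>x0\<close>. As \<open>A\<close> is symmetric, \<open>A[G x0]\<close> is the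
  distribution \<open>\<phi> \<mapsto> \<integral> G x0 A[\<phi>]\<close>; for this to be defined, test functions must lie in the
  domain and the integral must converge.
\<close>

definition green_function ::
  "('a::euclidean_space \<Rightarrow> real) set \<Rightarrow> (('a \<Rightarrow> real) \<Rightarrow> ('a \<Rightarrow> real)) \<Rightarrow>
   ('a \<Rightarrow> 'a \<Rightarrow> real) \<Rightarrow> bool" where
  "green_function D A G \<longleftrightarrow>
     (\<forall>x0.
        L1_loc (G x0) \<and>
        (AE x in lebesgue. 0 \<le> G x0 x \<and> G x0 x = G 0 (x - x0) \<and> G x0 x = G 0 (x0 - x)) \<and>
        (\<forall>\<phi>. test_function \<phi> \<longrightarrow>
           \<phi> \<in> D \<and> integrable lebesgue (\<lambda>x. G x0 x * A \<phi> x) \<and>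
           (LINT x|lebesgue. G x0 x * A \<phi> x) = \<phi> x0))"

definition inv_converges :: "('a::euclidean_space \<Rightarrow> 'a \<Rightarrow> real) \<Rightarrow> ('a \<Rightarrow> real) \<Rightarrow> 'a \<Rightarrow> bool" where
  "inv_converges G f y \<longleftrightarrow> integrable lebesgue (\<lambda>x. G 0 (x - y) * f x)"

definition inv_op :: "('a::euclidean_space \<Rightarrow> 'a \<Rightarrow> real) \<Rightarrow> ('a \<Rightarrow> real) \<Rightarrow> 'a \<Rightarrow> real" where
  "inv_op G f y = (LINT x|lebesgue. G 0 (x - y) * f x)"


section \<open>Weak dual solutions\<close>

text \<open>
  \<open>\<psi> \<in> C\<^sup>1\<^sub>c([a,b]; L\<^sup>\<infinity>\<^sub>c)\<close> with time derivative \<open>\<psi>'\<close>: differentiability and continuity are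
  with respect to the \<open>L\<^sup>\<infinity>\<close> norm, and one compact set carries all \<open>\<psi> t\<close>.
\<close>

definition C1c_Linf ::
  "real \<Rightarrow> real \<Rightarrow> (real \<Rightarrow> 'a::euclidean_space \<Rightarrow> real) \<Rightarrow> (real \<Rightarrow> 'a \<Rightarrow> real) \<Rightarrow> bool" where
  "C1c_Linf a b \<psi> \<psi>' \<longleftrightarrow>
     (\<exists>K. compact K \<and> (\<forall>t\<in>{a..b}. AE x in lebesgue. x \<notin> K \<longrightarrow> \<psi> t x = 0)) \<and>
     (\<forall>t\<in>{a..b}. in_Lp \<infinity> (\<psi> t) \<and> in_Lp \<infinity> (\<psi>' t)) \<and>
     (\<forall>t\<in>{a..b}.
        ((\<lambda>s. Lp_norm \<infinity> (\<lambda>x. (\<psi> s x - \<psi> t x) / (s - t) - \<psi>' t x)) \<longlongrightarrow> 0)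
          (at t within {a..b})) \<and>
     (\<forall>t\<in>{a..b}.
        ((\<lambda>s. Lp_norm \<infinity> (\<lambda>x. \<psi>' s x - \<psi>' t x)) \<longlongrightarrow> 0) (at t within {a..b}))"

definition cont_L1 :: "real \<Rightarrow> (real \<Rightarrow> 'a::euclidean_space \<Rightarrow> real) \<Rightarrow> bool" where
  "cont_L1 T u \<longleftrightarrow>
     (\<forall>t\<in>{0..T}. integrable lebesgue (u t)) \<and>
     (\<forall>t\<in>{0..T}. ((\<lambda>s. Lp_norm 1 (\<lambda>x. u s x - u t x)) \<longlongrightarrow> 0) (at t within {0..T}))"

text \<open>
  The integrability clauses below say that every integral occurring in the weak formulation
  exists. The double integral is iterated because \<open>\<psi>\<close> is a curve of classes, whose
  representatives need not be chosen jointly measurable. ``Almost every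
  \<open>0 < \<tau>\<^sub>1 \<le> \<tau>\<^sub>2 \<le> T\<close>'' refers to the planar measure of the pairs \<open>\<tau> = (\<tau>\<^sub>1, \<tau>\<^sub>2)\<close>, and the
  exceptional set does not depend on \<open>\<psi>\<close>.
\<close>

definition dual_identity ::
  "('a::euclidean_space \<Rightarrow> 'a \<Rightarrow> real) \<Rightarrow> real \<Rightarrow> (real \<Rightarrow> 'a \<Rightarrow> real) \<Rightarrow>
   real \<Rightarrow> real \<Rightarrow> (real \<Rightarrow> 'a \<Rightarrow> real) \<Rightarrow> (real \<Rightarrow> 'a \<Rightarrow> real) \<Rightarrow> bool" where
  "dual_identity G m u \<tau>\<^sub>1 \<tau>\<^sub>2 \<psi> \<psi>' \<longleftrightarrow>
     (AE t in lebesgue_on {\<tau>\<^sub>1..\<tau>\<^sub>2}.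
        integrable lebesgue (\<lambda>x. inv_op G (u t) x * \<psi>' t x - u t x powr m * \<psi> t x)) \<and>
     integrable lebesgue (\<lambda>x. inv_op G (u \<tau>\<^sub>1) x * \<psi> \<tau>\<^sub>1 x) \<and>
     integrable lebesgue (\<lambda>x. inv_op G (u \<tau>\<^sub>2) x * \<psi> \<tau>\<^sub>2 x) \<and>
     has_bochner_integral (lebesgue_on {\<tau>\<^sub>1..\<tau>\<^sub>2})
       (\<lambda>t. LINT x|lebesgue. inv_op G (u t) x * \<psi>' t x - u t x powr m * \<psi> t x)
       ((LINT x|lebesgue. inv_op G (u \<tau>\<^sub>2) x * \<psi> \<tau>\<^sub>2 x) -
        (LINT x|lebesgue. inv_op G (u \<tau>\<^sub>1) x * \<psi> \<tau>\<^sub>1 x))"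

definition weak_dual_solution_upto ::
  "('a::euclidean_space \<Rightarrow> 'a \<Rightarrow> real) \<Rightarrow> real \<Rightarrow> real \<Rightarrow> ('a \<Rightarrow> real) \<Rightarrow>
   (real \<Rightarrow> 'a \<Rightarrow> real) \<Rightarrow> bool" where
  "weak_dual_solution_upto G m T u\<^sub>0 u \<longleftrightarrow>
     (\<lambda>(t, x). u t x) \<in> borel_measurable (lebesgue_on ({0..T} \<times> UNIV)) \<and>
     (AE (t, x) in lebesgue_on ({0..T} \<times> UNIV). 0 \<le> u t x) \<and>
     cont_L1 T u \<and>
     (\<forall>K. compact K \<longrightarrow> set_integrable lebesgue ({0<..<T} \<times> K) (\<lambda>(t, x). u t x powr m)) \<and>
     (AE t in lebesgue_on {0<..T}. AE y in lebesgue. inv_converges G (u t) y) \<and>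
     (AE (\<tau>\<^sub>1, \<tau>\<^sub>2) in lebesgue. 0 < \<tau>\<^sub>1 \<and> \<tau>\<^sub>1 \<le> \<tau>\<^sub>2 \<and> \<tau>\<^sub>2 \<le> T \<longrightarrow>
        (\<forall>\<psi> \<psi>'. C1c_Linf \<tau>\<^sub>1 \<tau>\<^sub>2 \<psi> \<psi>' \<longrightarrow> dual_identity G m u \<tau>\<^sub>1 \<tau>\<^sub>2 \<psi> \<psi>')) \<and>
     (AE x in lebesgue. u 0 x = u\<^sub>0 x)"

definition weak_dual_solution ::
  "('a::euclidean_space \<Rightarrow> 'a \<Rightarrow> real) \<Rightarrow> real \<Rightarrow> ('a \<Rightarrow> real) \<Rightarrow> (real \<Rightarrow> 'a \<Rightarrow> real) \<Rightarrow> bool" where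
  "weak_dual_solution G m u\<^sub>0 u \<longleftrightarrow> (\<forall>T>0. weak_dual_solution_upto G m T u\<^sub>0 u)"

definition initial_datum :: "('a::euclidean_space \<Rightarrow> real) \<Rightarrow> bool" where
  "initial_datum u\<^sub>0 \<longleftrightarrow> integrable lebesgue u\<^sub>0 \<and> (AE x in lebesgue. 0 \<le> u\<^sub>0 x)"

definition comparison_principle :: "('a::euclidean_space \<Rightarrow> 'a \<Rightarrow> real) \<Rightarrow> real \<Rightarrow> bool" where
  "comparison_principle G m \<longleftrightarrow>
     (\<forall>u\<^sub>0 v\<^sub>0 u v. initial_datum u\<^sub>0 \<longrightarrow> initial_datum v\<^sub>0 \<longrightarrow>
        weak_dual_solution G m u\<^sub>0 u \<longrightarrow> weak_dual_solution G m v\<^sub>0 v \<longrightarrow>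
        (AE x in lebesgue. u\<^sub>0 x \<le> v\<^sub>0 x) \<longrightarrow>
        (AE (t, x) in lebesgue. 0 < t \<longrightarrow> u t x \<le> v t x))"

definition Lp_decay :: "('a::euclidean_space \<Rightarrow> 'a \<Rightarrow> real) \<Rightarrow> real \<Rightarrow> bool" where
  "Lp_decay G m \<longleftrightarrow>
     (\<forall>u\<^sub>0 u. initial_datum u\<^sub>0 \<longrightarrow> weak_dual_solution G m u\<^sub>0 u \<longrightarrow>
        (\<forall>p\<ge>1. AE (\<tau>\<^sub>1, \<tau>\<^sub>2) in lebesgue. 0 \<le> \<tau>\<^sub>1 \<and> \<tau>\<^sub>1 \<le> \<tau>\<^sub>2 \<longrightarrow>
           Lp_norm p (u \<tau>\<^sub>2) \<le> Lp_norm p (u \<tau>\<^sub>1)))"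

end

theory Submission
  imports Defs
begin

text \<open>
  Let \<open>U = u(\<tau>)\<close> for a generic time \<open>\<tau> > 0\<close>, put \<open>K = 2\<^bsup>m/(m-1)\<^esup> / \<tau>\<close>, let \<open>g\<close> be the Green function
  with pole \<open>0\<close>, and write \<open>(g \<star> U)(y) = \<integral> g(x - y) U(x) dx\<close>. The argument has two halves: the
  inequality \<open>U\<^bsup>m\<^esup> \<le> K g \<star> U\<close> almost everywhere, and its consequence
  \<open>U \<le> (K C\<^sub>1)\<^bsup>1/(m-1)\<^esup>\<close>.

  For the first half, \<open>\<lambda>\<^bsup>1/(m-1)\<^esup> u(\<lambda>t, x)\<close> is again a weak dual solution, and for \<open>\<lambda> \<ge> 1\<close> its
  initial datum dominates \<open>u\<^sub>0\<close>. By comparison \<open>t\<^bsup>1/(m-1)\<^esup> u(t)\<close> is nondecreasing, so that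
  \<open>U\<^bsup>m\<^esup> \<le> 2\<^bsup>m/(m-1)\<^esup> u(t)\<^bsup>m\<^esup>\<close> for \<open>\<tau> \<le> t \<le> 2\<tau>\<close>
  (lemma \<open>comparison_time_monotone\<close>). Testing the weak formulation with the indicator function
  of a bounded set, constant in time, on an interval that contains \<open>[\<tau>, 2\<tau>]\<close>, and dropping the
  term at the final time gives the inequality (lemma \<open>fundamental_upper_bound\<close>).

  For the second half, choose \<open>B > 0\<close> with \<open>B\<^bsup>m-1\<^esup> = K C\<^sub>1\<close>. As \<open>g\<close> has mass at
  most \<open>C\<^sub>1\<close> and \<open>U \<le> B + (U - B)\<^sup>+\<close>, the inequality implies
  \<open>(U\<^bsup>m\<^esup> - B\<^bsup>m\<^esup>)\<^sup>+ \<le> K g \<star> (U - B)\<^sup>+\<close>, hence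
  \<open>\<integral> (U\<^bsup>m\<^esup> - B\<^bsup>m\<^esup>)\<^sup>+ / B\<^bsup>m-1\<^esup> \<le> \<integral> (U - B)\<^sup>+ < \<infinity>\<close>. But the integrand on the left is strictly
  larger than the one on the right wherever \<open>U > B\<close>, so this set is null (lemma
  \<open>convolution_inequality_bound\<close>). Since \<open>U\<close> only has to be integrable here, it is not necessary to
  know beforehand that \<open>U\<close> is bounded, and no approximation by bounded data is needed.
\<close>

section \<open>Lebesgue measure on products and under affine maps\<close>

lemma AE_lebesgue_prodD:
  fixes P :: "'a::euclidean_space \<times> 'b::euclidean_space \<Rightarrow> bool"
  assumes "AE p in lebesgue. P p"
  shows "AE a in lebesgue. AE b in lebesgue. P (a, b)"
proof -
  have "AE p in lborel \<Otimes>\<^sub>M lborel. P p"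
    using assms unfolding AE_completion_iff lborel_prod .
  then have "AE a in lborel. AE b in lborel. P (a, b)"
    by (rule lborel_pair.AE_pair)
  then show ?thesis
    by (simp add: AE_completion_iff)
qed

lemma L1_loc_measurable:
  fixes f :: "'a::euclidean_space \<Rightarrow> real"
  assumes "L1_loc f"
  shows "f \<in> borel_measurable lebesgue"
proof (rule borel_measurable_LIMSEQ_real)
  fix n :: nat
  have "set_integrable lebesgue (cball 0 (real n)) f"
    using assms by (simp add: L1_loc_def)
  then show "(\<lambda>x. indicat_real (cball 0 (real n)) x * f x) \<in> borel_measurable lebesgue"
    unfolding set_integrable_def by (auto dest: borel_measurable_integrable)
next
  fix x :: 'a
  obtain N where "norm x < real N" using reals_Archimedean2 by blast
  then have "\<forall>\<^sub>F n in sequentially. indicat_real (cball 0 (real n)) x * f x = f x"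
    by (intro eventually_sequentiallyI[of N]) (auto simp: indicator_def)
  then show "(\<lambda>n. indicat_real (cball 0 (real n)) x * f x) \<longlonglongrightarrow> f x"
    by (rule tendsto_eventually)
qed

text \<open>
  \<open>T\<close> scales Lebesgue measure by a constant: the measure of \<open>A\<close> is \<open>k\<close> times the measure of the
  preimage of \<open>A\<close> under \<open>T\<close>. For invertible affine maps \<open>k\<close> is the absolute value of the determinant.
\<close>

definition scaling_map :: "real \<Rightarrow> ('a::euclidean_space \<Rightarrow> 'a) \<Rightarrow> bool" where
  "scaling_map k T \<longleftrightarrow> k > 0 \<and> T \<in> lebesgue \<rightarrow>\<^sub>M lebesgue \<and>
     lebesgue = density (distr lebesgue lebesgue T) (\<lambda>_. ennreal k)"

lemma AE_scaling_map:
  assumes T: "scaling_map k T" and P: "AE x in lebesgue. P x"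
  shows "AE x in lebesgue. P (T x)"
proof -
  from T have k: "k > 0" and Tm: "T \<in> lebesgue \<rightarrow>\<^sub>M lebesgue"
    and eq: "lebesgue = density (distr lebesgue lebesgue T) (\<lambda>_. ennreal k)"
    by (auto simp: scaling_map_def)
  from P obtain N where N: "N \<in> null_sets lebesgue" "{x \<in> space lebesgue. \<not> P x} \<subseteq> N"
    by (auto simp: eventually_ae_filter)
  have Ns: "N \<in> sets lebesgue" using N by auto
  have "0 = emeasure lebesgue N" using N by auto
  also have "\<dots> = emeasure (density (distr lebesgue lebesgue T) (\<lambda>_. ennreal k)) N"
    by (metis eq)
  also have "\<dots> = ennreal k * emeasure (distr lebesgue lebesgue T) N"
    using Ns by (subst emeasure_density) (auto simp: nn_integral_cmult_indicator)
  also have "\<dots> = ennreal k * emeasure lebesgue (T -` N \<inter> space lebesgue)"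
    using Ns Tm by (simp add: emeasure_distr)
  finally have "emeasure lebesgue (T -` N \<inter> space lebesgue) = 0" using k by auto
  moreover have "T -` N \<inter> space lebesgue \<in> sets lebesgue"
    using Tm Ns by (rule measurable_sets)
  ultimately have "T -` N \<inter> space lebesgue \<in> null_sets lebesgue" by (auto intro: null_setsI)
  then show ?thesis by (rule AE_I') (use N in auto)
qed

lemma measurable_scaling_map:
  assumes T: "scaling_map k T" and f: "f \<in> borel_measurable lebesgue"
  shows "(\<lambda>x. f (T x)) \<in> borel_measurable lebesgue"
  using T f unfolding scaling_map_def by (auto intro: measurable_compose)

lemma nn_integral_scaling_map:
  assumes T: "scaling_map k T" and f: "f \<in> borel_measurable lebesgue"
  shows "(\<integral>\<^sup>+x. f x \<partial>lebesgue) = ennreal k * (\<integral>\<^sup>+x. f (T x) \<partial>lebesgue)"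
proof -
  from T have k: "k > 0" and Tm: "T \<in> lebesgue \<rightarrow>\<^sub>M lebesgue"
    and eq: "lebesgue = density (distr lebesgue lebesgue T) (\<lambda>_. ennreal k)"
    by (auto simp: scaling_map_def)
  have "(\<integral>\<^sup>+x. f x \<partial>lebesgue) =
      (\<integral>\<^sup>+x. f x \<partial>density (distr lebesgue lebesgue T) (\<lambda>_. ennreal k))"
    by (metis eq)
  also have "\<dots> = ennreal k * (\<integral>\<^sup>+x. f x \<partial>distr lebesgue lebesgue T)"
    using f by (subst nn_integral_density) (auto simp: nn_integral_cmult)
  also have "\<dots> = ennreal k * (\<integral>\<^sup>+x. f (T x) \<partial>lebesgue)"
    using f Tm by (simp add: nn_integral_distr)
  finally show ?thesis .
qed

lemma integrable_scaling_map:
  fixes f :: "'a::euclidean_space \<Rightarrow> real"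
  assumes T: "scaling_map k T" and f: "integrable lebesgue f"
  shows "integrable lebesgue (\<lambda>x. f (T x))"
proof -
  have k: "k > 0" using T by (simp add: scaling_map_def)
  have fm: "f \<in> borel_measurable lebesgue" using f by auto
  have "ennreal k * (\<integral>\<^sup>+x. norm (f (T x)) \<partial>lebesgue) < \<infinity>"
    using f nn_integral_scaling_map[OF T, of "\<lambda>x. ennreal (norm (f x))"] fm
    by (simp add: integrable_iff_bounded del: real_norm_def)
  then have "(\<integral>\<^sup>+x. norm (f (T x)) \<partial>lebesgue) < \<infinity>"
    using k by (auto simp: ennreal_mult_less_top)
  then show ?thesis
    using measurable_scaling_map[OF T fm] by (auto simp: integrable_iff_bounded)
qed

lemma scaling_map_affine:
  fixes c :: real and t :: "'a::euclidean_space"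
  assumes "c \<noteq> 0"
  shows "scaling_map (\<bar>c\<bar> ^ DIM('a)) (\<lambda>x. t + c *\<^sub>R x)"
proof -
  have eq: "(\<lambda>x. t + (\<Sum>j\<in>Basis. (c * (x \<bullet> j)) *\<^sub>R j)) = (\<lambda>x. t + c *\<^sub>R x)"
    by (auto simp: fun_eq_iff scaleR_scaleR[symmetric] scaleR_sum_right[symmetric]
        euclidean_representation simp del: scaleR_scaleR)
  show ?thesis
    using lebesgue_affine_euclidean[of "\<lambda>_. c" t] lebesgue_affine_measurable[of "\<lambda>_. c" t] assms
    unfolding scaling_map_def eq by simp
qed

text \<open>The dilation of the time variable alone, on space-time.\<close>

lemma scaling_map_time:
  fixes c :: real
  assumes "c > 0"
  shows "scaling_map c (\<lambda>p :: real \<times> 'a::euclidean_space. (c * fst p, snd p))"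
proof -
  define d where "d = (\<lambda>j :: real \<times> 'a. if j = (1, 0) then c else 1)"
  have d: "d j \<noteq> 0" for j using assms by (simp add: d_def)
  have "(\<Sum>j\<in>Basis. (d j * (p \<bullet> j)) *\<^sub>R j) = (c * fst p, snd p)" for p :: "real \<times> 'a"
  proof (rule euclidean_eqI)
    fix b :: "real \<times> 'a" assume b: "b \<in> Basis"
    have "(\<Sum>j\<in>Basis. (d j * (p \<bullet> j)) *\<^sub>R j) \<bullet> b = d b * (p \<bullet> b)"
      using b by (rule inner_sum_left_Basis)
    then show "(\<Sum>j\<in>Basis. (d j * (p \<bullet> j)) *\<^sub>R j) \<bullet> b = (c * fst p, snd p) \<bullet> b"
      using b by (cases p) (auto simp: Basis_prod_def d_def)
  qed
  then have eq: "(\<lambda>x. 0 + (\<Sum>j\<in>Basis. (d j * (x \<bullet> j)) *\<^sub>R j)) = (\<lambda>p. (c * fst p, snd p))"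
    by auto
  have "(\<Prod>j\<in>Basis. \<bar>d j\<bar>) = c"
  proof -
    have "(\<Prod>j\<in>Basis. \<bar>d j\<bar>) = (\<Prod>j\<in>(Basis :: (real \<times> 'a) set). if j = (1,0) then c else 1)"
      using assms by (intro prod.cong) (auto simp: d_def)
    also have "\<dots> = c" by (subst prod.delta) (auto simp: Basis_prod_def)
    finally show ?thesis .
  qed
  then show ?thesis
    using lebesgue_affine_euclidean[of d 0] lebesgue_affine_measurable[of d 0] assms d
    unfolding scaling_map_def eq by simp
qed

lemma ennreal_integral_le_nn_integral:
  "ennreal (LINT x|M. f x) \<le> (\<integral>\<^sup>+x. ennreal (f x) \<partial>M)" for f :: "'a \<Rightarrow> real"
proof (cases "integrable M f")
  case True
  have "(LINT x|M. f x) \<le> (LINT x|M. max 0 (f x))"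
    using True by (intro integral_mono) auto
  then have "ennreal (LINT x|M. f x) \<le> ennreal (LINT x|M. max 0 (f x))" by (rule ennreal_leI)
  also have "\<dots> = (\<integral>\<^sup>+x. ennreal (max 0 (f x)) \<partial>M)"
    using True by (subst nn_integral_eq_integral) auto
  also have "\<dots> = (\<integral>\<^sup>+x. ennreal (f x) \<partial>M)" by (simp add: ennreal_max_0)
  finally show ?thesis .
qed (simp add: not_integrable_integral_eq)

section \<open>Integrable functions dominated by their own convolution\<close>

text \<open>
  The integral on the right-hand side of the hypothesis may fail to converge at some \<open>y\<close>; it is then
  \<open>0\<close> by convention, which only strengthens the hypothesis. For Tonelli's theorem the functions
  \<open>g\<close> and \<open>U\<close> are replaced by Borel representatives.
\<close>

lemma convolution_inequality_bound:
  fixes g U :: "'a::euclidean_space \<Rightarrow> real"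
  assumes g: "g \<in> borel_measurable lebesgue" "AE x in lebesgue. 0 \<le> g x"
    and gC: "(\<integral>\<^sup>+x. ennreal (g x) \<partial>lebesgue) \<le> ennreal C"
    and U: "integrable lebesgue U" "AE x in lebesgue. 0 \<le> U x"
    and pos: "K > 0" "C > 0" "B > 0" and m: "m > 1" and B: "B powr (m - 1) = K * C"
    and le: "AE y in lebesgue. U y powr m \<le> K * (LINT x|lebesgue. g (x - y) * U x)"
  shows "AE x in lebesgue. U x \<le> B"
proof -
  from completion_ex_borel_measurable_real[OF g(1)] obtain g' where
    g'[measurable]: "g' \<in> borel_measurable lborel" and gg': "AE x in lborel. g x = g' x" by auto
  from completion_ex_borel_measurable_real[OF borel_measurable_integrable[OF U(1)]] obtain U' where
    U'[measurable]: "U' \<in> borel_measurable lborel" and UU': "AE x in lborel. U x = U' x" by auto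
  have [measurable]: "g' \<in> borel_measurable borel" "U' \<in> borel_measurable borel"
    using g' U' by auto
  have gg: "AE x in lebesgue. g x = g' x" using gg' by (rule AE_completion)
  have UU: "AE x in lebesgue. U x = U' x" using UU' by (rule AE_completion)
  define w where "w = (\<lambda>x. ennreal (U' x - B))"
  have [measurable]: "w \<in> borel_measurable borel" unfolding w_def by measurable
  define gw where "gw = (\<lambda>y. \<integral>\<^sup>+x. ennreal (g' (x - y)) * w x \<partial>lborel)"
  have [measurable]: "gw \<in> borel_measurable borel" unfolding gw_def by measurable
  have gC': "(\<integral>\<^sup>+x. ennreal (g' x) \<partial>lborel) \<le> ennreal C"
  proof -
    have "(\<integral>\<^sup>+x. ennreal (g' x) \<partial>lborel) = (\<integral>\<^sup>+x. ennreal (g' x) \<partial>lebesgue)"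
      by (simp add: nn_integral_completion)
    also have "\<dots> = (\<integral>\<^sup>+x. ennreal (g x) \<partial>lebesgue)"
      using gg by (intro nn_integral_cong_AE) auto
    finally show ?thesis using gC by simp
  qed
  have shift1: "(\<integral>\<^sup>+x. ennreal (g' (x - y)) \<partial>lborel) \<le> ennreal C" for y
    using nn_integral_scaling_map[OF scaling_map_affine[of 1 "- y"], of "\<lambda>x. ennreal (g' x)"] gC'
    by (simp add: nn_integral_completion measurable_completion)
  have shift2: "(\<integral>\<^sup>+y. ennreal (g' (x - y)) \<partial>lborel) \<le> ennreal C" for x
    using nn_integral_scaling_map[OF scaling_map_affine[of "- 1" x], of "\<lambda>x. ennreal (g' x)"] gC'
    by (simp add: nn_integral_completion measurable_completion)
  have wfin: "(\<integral>\<^sup>+x. w x \<partial>lborel) < \<infinity>"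
  proof -
    have "(\<integral>\<^sup>+x. w x \<partial>lborel) = (\<integral>\<^sup>+x. w x \<partial>lebesgue)" by (simp add: nn_integral_completion)
    also have "\<dots> \<le> (\<integral>\<^sup>+x. ennreal (norm (U x)) \<partial>lebesgue)"
      using UU pos by (intro nn_integral_mono_AE) (auto simp: w_def intro!: ennreal_leI)
    also have "\<dots> < \<infinity>" using U(1) by (simp add: integrable_iff_bounded)
    finally show ?thesis .
  qed
  have gwint: "(\<integral>\<^sup>+y. gw y \<partial>lborel) \<le> ennreal C * (\<integral>\<^sup>+x. w x \<partial>lborel)"
  proof -
    have "(\<integral>\<^sup>+y. gw y \<partial>lborel) = (\<integral>\<^sup>+x. (\<integral>\<^sup>+y. ennreal (g' (x - y)) * w x \<partial>lborel) \<partial>lborel)"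
      unfolding gw_def by (rule lborel_pair.Fubini') measurable
    also have "\<dots> = (\<integral>\<^sup>+x. (\<integral>\<^sup>+y. ennreal (g' (x - y)) \<partial>lborel) * w x \<partial>lborel)"
      by (intro nn_integral_cong nn_integral_multc) measurable
    also have "\<dots> \<le> (\<integral>\<^sup>+x. ennreal C * w x \<partial>lborel)"
      by (intro nn_integral_mono mult_right_mono shift2) auto
    also have "\<dots> = ennreal C * (\<integral>\<^sup>+x. w x \<partial>lborel)" by (intro nn_integral_cmult) measurable
    finally show ?thesis .
  qed
  have Bm: "B powr m = K * C * B"
  proof -
    have "B powr m = B powr (m - 1) * B powr 1" by (subst powr_add[symmetric]) simp
    then show ?thesis using B pos by simp
  qed
  have conv: "ennreal (LINT x|lebesgue. g (x - y) * U x) \<le> ennreal (C * B) + gw y" for y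
  proof -
    have ggy: "AE x in lebesgue. g (x - y) = g' (x - y)"
      using AE_scaling_map[OF scaling_map_affine[of 1 "- y"] gg] by simp
    have gpy: "AE x in lebesgue. 0 \<le> g (x - y)"
      using AE_scaling_map[OF scaling_map_affine[of 1 "- y"] g(2)] by simp
    have "ennreal (LINT x|lebesgue. g (x - y) * U x) \<le> (\<integral>\<^sup>+x. ennreal (g (x - y) * U x) \<partial>lebesgue)"
      by (rule ennreal_integral_le_nn_integral)
    also have "\<dots> \<le> (\<integral>\<^sup>+x. ennreal (g' (x - y)) * (ennreal B + w x) \<partial>lebesgue)"
      using ggy gpy U(2) UU
    proof (intro nn_integral_mono_AE, eventually_elim)
      fix x assume *: "g (x - y) = g' (x - y)" "0 \<le> g (x - y)" "0 \<le> U x" "U x = U' x"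
      have "ennreal (U x) = ennreal (B + (U' x - B))" using * by simp
      also have "\<dots> \<le> ennreal B + w x" unfolding w_def
        by (cases "U' x - B \<ge> 0") (use pos in \<open>auto simp: ennreal_plus[symmetric] ennreal_neg
            intro!: ennreal_leI simp del: ennreal_plus\<close>)
      finally show "ennreal (g (x - y) * U x) \<le> ennreal (g' (x - y)) * (ennreal B + w x)"
        using * by (auto simp: ennreal_mult intro!: mult_left_mono)
    qed
    also have "\<dots> = (\<integral>\<^sup>+x. ennreal (g' (x - y)) * (ennreal B + w x) \<partial>lborel)"
      by (simp add: nn_integral_completion)
    also have "\<dots> = (\<integral>\<^sup>+x. ennreal (g' (x - y)) * ennreal B + ennreal (g' (x - y)) * w x \<partial>lborel)"
      by (simp add: distrib_left)
    also have "\<dots> = (\<integral>\<^sup>+x. ennreal (g' (x - y)) * ennreal B \<partial>lborel) + gw y"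
      unfolding gw_def by (rule nn_integral_add) measurable
    also have "\<dots> = (\<integral>\<^sup>+x. ennreal (g' (x - y)) \<partial>lborel) * ennreal B + gw y"
      by (subst nn_integral_multc) auto
    also have "\<dots> \<le> ennreal C * ennreal B + gw y"
      by (intro add_right_mono mult_right_mono shift1) auto
    finally show ?thesis using pos by (simp add: ennreal_mult)
  qed
  \<comment> \<open>The constant is \<open>B powr (m - 1) = K * C\<close>.\<close>
  define h where "h = (\<lambda>x. ennreal ((U' x powr m - B powr m) / (K * C)))"
  have [measurable]: "h \<in> borel_measurable borel" unfolding h_def by measurable
  have hle: "AE y in lborel. h y \<le> ennreal (1 / C) * gw y"
  proof -
    have "AE y in lborel. U y powr m \<le> K * (LINT x|lebesgue. g (x - y) * U x)"
      using le by (simp add: AE_completion_iff)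
    then show ?thesis using UU'
    proof eventually_elim
      fix y assume *: "U y powr m \<le> K * (LINT x|lebesgue. g (x - y) * U x)" "U y = U' y"
      have "ennreal (U' y powr m) \<le> ennreal K * ennreal (LINT x|lebesgue. g (x - y) * U x)"
        using * pos by (subst ennreal_mult'[symmetric]) (auto intro!: ennreal_leI)
      also have "\<dots> \<le> ennreal K * (ennreal (C * B) + gw y)"
        by (intro mult_left_mono conv) auto
      also have "\<dots> = ennreal (B powr m) + ennreal K * gw y"
        using pos by (simp add: Bm distrib_left ennreal_mult mult.assoc)
      finally have "ennreal (U' y powr m) - ennreal (B powr m) \<le> ennreal K * gw y"
        by (simp add: ennreal_minus_le_iff)
      then have **: "ennreal (U' y powr m - B powr m) \<le> ennreal K * gw y"
        by (simp add: ennreal_minus)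
      have "h y = ennreal (1 / (K * C)) * ennreal (U' y powr m - B powr m)"
        unfolding h_def using pos by (subst ennreal_mult'[symmetric]) auto
      also have "\<dots> \<le> ennreal (1 / (K * C)) * (ennreal K * gw y)"
        by (intro mult_left_mono **) auto
      also have "\<dots> = ennreal (1 / C) * gw y"
        using pos by (simp add: mult.assoc[symmetric] ennreal_mult'[symmetric])
      finally show "h y \<le> ennreal (1 / C) * gw y" .
    qed
  qed
  have "(\<integral>\<^sup>+y. h y \<partial>lborel) \<le> (\<integral>\<^sup>+y. ennreal (1 / C) * gw y \<partial>lborel)"
    by (rule nn_integral_mono_AE[OF hle])
  also have "\<dots> = ennreal (1 / C) * (\<integral>\<^sup>+y. gw y \<partial>lborel)" by (intro nn_integral_cmult) measurable
  also have "\<dots> \<le> ennreal (1 / C) * (ennreal C * (\<integral>\<^sup>+x. w x \<partial>lborel))"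
    by (intro mult_left_mono gwint) auto
  also have "\<dots> = (\<integral>\<^sup>+x. w x \<partial>lborel)"
    using pos by (simp add: mult.assoc[symmetric] ennreal_mult'[symmetric])
  finally have hw: "(\<integral>\<^sup>+y. h y \<partial>lborel) \<le> (\<integral>\<^sup>+x. w x \<partial>lborel)" .
  \<comment> \<open>Since \<open>U'\<^bsup>m\<^esup> > B\<^bsup>m-1\<^esup> U'\<close> where \<open>U' > B\<close>; here \<open>m > 1\<close> enters.\<close>
  have strict: "U' x - B < (U' x powr m - B powr m) / (K * C)" if "U' x > B" for x
  proof -
    have "B powr (m - 1) < U' x powr (m - 1)" using that pos m by (intro powr_less_mono2) auto
    then have "U' x * B powr (m - 1) < U' x * U' x powr (m - 1)" using that pos by auto
    also have "\<dots> = U' x powr m"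
    proof -
      have "U' x powr m = U' x powr (m - 1) * U' x powr 1" by (subst powr_add[symmetric]) simp
      then show ?thesis using that pos by simp
    qed
    finally show ?thesis unfolding Bm B using pos by (simp add: field_simps)
  qed
  have wh: "w x \<le> h x" for x
    by (cases "U' x > B") (auto simp: w_def h_def ennreal_neg intro!: ennreal_leI less_imp_le[OF strict])
  \<comment> \<open>Subtraction of extended reals is harmless because \<open>w\<close> has a finite integral.\<close>
  have "(\<integral>\<^sup>+x. h x - w x \<partial>lborel) = (\<integral>\<^sup>+x. h x \<partial>lborel) - (\<integral>\<^sup>+x. w x \<partial>lborel)"
    using wfin wh by (intro nn_integral_diff) (auto simp: less_top)
  also have "\<dots> = 0" using hw wfin by (simp add: diff_eq_0_iff_ennreal)
  finally have "AE x in lborel. h x - w x = 0" by (subst (asm) nn_integral_0_iff_AE) auto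
  then have "AE x in lborel. U' x \<le> B"
  proof eventually_elim
    fix x assume "h x - w x = 0"
    then have "h x \<le> w x" by (auto simp: diff_eq_0_iff_ennreal w_def)
    then show "U' x \<le> B"
      using strict[of x] unfolding h_def w_def by (cases "U' x > B") (auto simp: ennreal_le_iff2)
  qed
  with UU' have "AE x in lborel. U x \<le> B" by eventually_elim simp
  then show ?thesis by (rule AE_completion)
qed

section \<open>Time scaling of weak dual solutions\<close>

lemma Lp_norm_1_cmult:
  fixes f :: "'a::euclidean_space \<Rightarrow> real"
  assumes "f \<in> borel_measurable lebesgue"
  shows "Lp_norm 1 (\<lambda>x. c * f x) = ennreal \<bar>c\<bar> * Lp_norm 1 f"
  unfolding Lp_norm_1 using assms
  by (simp add: abs_mult ennreal_mult nn_integral_cmult)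

text \<open>
  No measurability is required: the essential supremum of a nonmeasurable function is \<open>\<infinity>\<close>, which
  is why \<open>c\<close> must not vanish.
\<close>

lemma Lp_norm_infinity_cmult_le:
  fixes f :: "'a::euclidean_space \<Rightarrow> real"
  assumes "c \<noteq> 0"
  shows "Lp_norm \<infinity> (\<lambda>x. c * f x) \<le> ennreal \<bar>c\<bar> * Lp_norm \<infinity> f"
proof (cases "(\<lambda>x. ennreal \<bar>f x\<bar>) \<in> borel_measurable lebesgue")
  case True
  have eq: "(\<lambda>x. ennreal \<bar>c * f x\<bar>) = (\<lambda>x. ennreal \<bar>c\<bar> * ennreal \<bar>f x\<bar>)"
    by (simp add: abs_mult ennreal_mult)
  have "AE x in lebesgue. ennreal \<bar>f x\<bar> \<le> esssup lebesgue (\<lambda>x. ennreal \<bar>f x\<bar>)"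
    by (rule esssup_AE)
  then have "AE x in lebesgue. ennreal \<bar>c\<bar> * ennreal \<bar>f x\<bar>
      \<le> ennreal \<bar>c\<bar> * esssup lebesgue (\<lambda>x. ennreal \<bar>f x\<bar>)"
    by eventually_elim (auto intro: mult_left_mono)
  then show ?thesis
    unfolding Lp_norm_def eq using True by (auto intro!: esssup_I)
next
  case False
  then show ?thesis
    using assms by (simp add: Lp_norm_def esssup_non_measurable ennreal_mult_top)
qed

lemma in_Lp_infinity_cmult:
  fixes f :: "'a::euclidean_space \<Rightarrow> real"
  assumes "in_Lp \<infinity> f" "c \<noteq> 0"
  shows "in_Lp \<infinity> (\<lambda>x. c * f x)"
proof -
  have "Lp_norm \<infinity> (\<lambda>x. c * f x) < \<infinity>"
    using Lp_norm_infinity_cmult_le[OF assms(2), of f] assms(1)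
    by (auto simp: in_Lp_def ennreal_mult_less_top intro: le_less_trans)
  then show ?thesis using assms(1) by (auto simp: in_Lp_def)
qed

lemma inv_op_cmult: "inv_op G (\<lambda>x. c * f x) y = c * inv_op G f y"
  unfolding inv_op_def by (simp add: mult.left_commute[of _ c])

lemma filterlim_scale_within:
  fixes c :: real
  assumes "c > 0"
  shows "filterlim (\<lambda>s. c * s) (at (c * t) within {c * a..c * b}) (at t within {a..b})"
  unfolding filterlim_at
proof (intro conjI)
  show "((\<lambda>s. c * s) \<longlongrightarrow> c * t) (at t within {a..b})" by (intro tendsto_intros)
  show "\<forall>\<^sub>F s in at t within {a..b}. c * s \<in> {c * a..c * b} \<and> c * s \<noteq> c * t"
    unfolding eventually_at_filter using assms by (auto intro!: always_eventually)
qed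

lemma C1c_Linf_scale:
  fixes \<psi> \<psi>' :: "real \<Rightarrow> 'a::euclidean_space \<Rightarrow> real"
  assumes \<psi>: "C1c_Linf a b \<psi> \<psi>'" and l: "l > 0"
  shows "C1c_Linf (l * a) (l * b) (\<lambda>s. \<psi> (s / l)) (\<lambda>s x. 1 / l * \<psi>' (s / l) x)"
proof -
  have mem: "s / l \<in> {a..b}" if "s \<in> {l * a..l * b}" for s
    using that l by (auto simp: field_simps)
  have flt: "filterlim (\<lambda>s. s / l) (at (t / l) within {a..b}) (at t within {l * a..l * b})" for t
    using filterlim_scale_within[of "1 / l" t "l * a" "l * b"] l by simp
  have il: "1 / l \<noteq> 0" using l by simp
  show ?thesis
    unfolding C1c_Linf_def
  proof (intro conjI ballI)
    obtain K where K: "compact K" "\<forall>t\<in>{a..b}. AE x in lebesgue. x \<notin> K \<longrightarrow> \<psi> t x = 0"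
      using \<psi> unfolding C1c_Linf_def by auto
    show "\<exists>K. compact K \<and>
        (\<forall>t\<in>{l * a..l * b}. AE x in lebesgue. x \<notin> K \<longrightarrow> \<psi> (t / l) x = 0)"
      using K mem by (intro exI[of _ K]) auto
  next
    fix t assume t: "t \<in> {l * a..l * b}"
    show "in_Lp \<infinity> (\<psi> (t / l))" using \<psi> mem[OF t] unfolding C1c_Linf_def by auto
    show "in_Lp \<infinity> (\<lambda>x. 1 / l * \<psi>' (t / l) x)"
      using \<psi> mem[OF t] unfolding C1c_Linf_def by (intro in_Lp_infinity_cmult il) auto
    have "((\<lambda>s. Lp_norm \<infinity> (\<lambda>x. (\<psi> s x - \<psi> (t / l) x) / (s - t / l) - \<psi>' (t / l) x)) \<longlongrightarrow> 0)
          (at (t / l) within {a..b})"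
      using \<psi> mem[OF t] unfolding C1c_Linf_def by blast
    from ennreal_tendsto_cmult[OF _ filterlim_compose[OF this flt], of "ennreal \<bar>1 / l\<bar>"]
    have lim: "((\<lambda>s. ennreal \<bar>1 / l\<bar> *
        Lp_norm \<infinity> (\<lambda>x. (\<psi> (s / l) x - \<psi> (t / l) x) / (s / l - t / l) - \<psi>' (t / l) x)) \<longlongrightarrow> 0)
          (at t within {l * a..l * b})" by simp
    have eq: "(\<lambda>x. (\<psi> (s / l) x - \<psi> (t / l) x) / (s - t) - 1 / l * \<psi>' (t / l) x) =
        (\<lambda>x. 1 / l * ((\<psi> (s / l) x - \<psi> (t / l) x) / (s / l - t / l) - \<psi>' (t / l) x))" for s
    proof
      fix x
      have "s / l - t / l = (s - t) / l" by (simp add: diff_divide_distrib)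
      then show "(\<psi> (s / l) x - \<psi> (t / l) x) / (s - t) - 1 / l * \<psi>' (t / l) x =
         1 / l * ((\<psi> (s / l) x - \<psi> (t / l) x) / (s / l - t / l) - \<psi>' (t / l) x)"
        using l by (cases "s = t") (auto simp: field_simps)
    qed
    show "((\<lambda>s. Lp_norm \<infinity> (\<lambda>x. (\<psi> (s / l) x - \<psi> (t / l) x) / (s - t) - 1 / l * \<psi>' (t / l) x))
        \<longlongrightarrow> 0) (at t within {l * a..l * b})"
      unfolding eq
      by (rule tendsto_sandwich[OF _ _ tendsto_const lim])
        (intro always_eventually allI zero_le Lp_norm_infinity_cmult_le il)+
    have "((\<lambda>s. Lp_norm \<infinity> (\<lambda>x. \<psi>' s x - \<psi>' (t / l) x)) \<longlongrightarrow> 0) (at (t / l) within {a..b})"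
      using \<psi> mem[OF t] unfolding C1c_Linf_def by blast
    from ennreal_tendsto_cmult[OF _ filterlim_compose[OF this flt], of "ennreal \<bar>1 / l\<bar>"]
    have lim: "((\<lambda>s. ennreal \<bar>1 / l\<bar> * Lp_norm \<infinity> (\<lambda>x. \<psi>' (s / l) x - \<psi>' (t / l) x)) \<longlongrightarrow> 0)
          (at t within {l * a..l * b})" by simp
    show "((\<lambda>s. Lp_norm \<infinity> (\<lambda>x. 1 / l * \<psi>' (s / l) x - 1 / l * \<psi>' (t / l) x)) \<longlongrightarrow> 0)
        (at t within {l * a..l * b})"
      unfolding right_diff_distrib[symmetric]
      by (rule tendsto_sandwich[OF _ _ tendsto_const lim])
        (intro always_eventually allI zero_le Lp_norm_infinity_cmult_le il)+
  qed
qed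

text \<open>
  For \<open>c > 0\<close> the hypothesis on \<open>c\<close> says \<open>c\<^bsup>m-1\<^esup> = l\<close>: the factor \<open>c\<^bsup>m\<^esup>\<close> from the nonlinearity then equals the
  factor \<open>c l\<close> from the time derivative.
\<close>

lemma dual_identity_scale:
  assumes id: "dual_identity G m u (l * \<tau>\<^sub>1) (l * \<tau>\<^sub>2) (\<lambda>s. \<psi> (s / l)) (\<lambda>s x. 1 / l * \<psi>' (s / l) x)"
    and l: "l > 0" and cm: "c powr m = c * l"
  shows "dual_identity G m (\<lambda>t x. c * u (l * t) x) \<tau>\<^sub>1 \<tau>\<^sub>2 \<psi> \<psi>'"
proof -
  let ?f = "\<lambda>s x. inv_op G (u s) x * (1 / l * \<psi>' (s / l) x) - u s x powr m * \<psi> (s / l) x"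
  have integrand: "inv_op G (\<lambda>x. c * u (l * t) x) x * \<psi>' t x - (c * u (l * t) x) powr m * \<psi> t x
      = (c * l) * ?f (l * t) x" for t x
    using l by (simp add: inv_op_cmult powr_mult cm field_simps)
  have ae: "AE s in lebesgue. s \<in> {l * \<tau>\<^sub>1..l * \<tau>\<^sub>2} \<longrightarrow> integrable lebesgue (?f s)"
    using id unfolding dual_identity_def by (simp add: AE_restrict_space_iff)
  have "AE t in lebesgue. l * t \<in> {l * \<tau>\<^sub>1..l * \<tau>\<^sub>2} \<longrightarrow> integrable lebesgue (?f (l * t))"
    using AE_scaling_map[OF scaling_map_affine[of l "0::real"] ae] l by simp
  then have 1: "AE t in lebesgue_on {\<tau>\<^sub>1..\<tau>\<^sub>2}. integrable lebesgue
      (\<lambda>x. inv_op G (\<lambda>x. c * u (l * t) x) x * \<psi>' t x - (c * u (l * t) x) powr m * \<psi> t x)"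
    unfolding integrand using l by (subst AE_restrict_space_iff) (auto elim!: eventually_mono)
  define I where "I = (LINT x|lebesgue. inv_op G (u (l * \<tau>\<^sub>2)) x * \<psi> (l * \<tau>\<^sub>2 / l) x) -
        (LINT x|lebesgue. inv_op G (u (l * \<tau>\<^sub>1)) x * \<psi> (l * \<tau>\<^sub>1 / l) x)"
  have "has_bochner_integral (lebesgue_on {l * \<tau>\<^sub>1..l * \<tau>\<^sub>2}) (\<lambda>s. LINT x|lebesgue. ?f s x) I"
    using id unfolding dual_identity_def I_def by blast
  then have "has_bochner_integral lebesgue
      (\<lambda>s. indicator {l * \<tau>\<^sub>1..l * \<tau>\<^sub>2} s *\<^sub>R (LINT x|lebesgue. ?f s x)) I"
    by (simp add: has_bochner_integral_restrict_space)
  then have "has_bochner_integral lebesgue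
      (\<lambda>t. indicator {l * \<tau>\<^sub>1..l * \<tau>\<^sub>2} (0 + l * t) *\<^sub>R (LINT x|lebesgue. ?f (0 + l * t) x)) (I /\<^sub>R \<bar>l\<bar>)"
    using l by (subst (asm) has_bochner_integral_lebesgue_real_affine_iff[of l _ _ 0]) auto
  from has_bochner_integral_mult_right[OF this, of "c * l"]
  have "has_bochner_integral lebesgue
      (\<lambda>t. (c * l) * (indicator {l * \<tau>\<^sub>1..l * \<tau>\<^sub>2} (l * t) *\<^sub>R (LINT x|lebesgue. ?f (l * t) x)))
      ((c * l) * (I /\<^sub>R \<bar>l\<bar>))"
    by simp
  moreover have "indicator {l * \<tau>\<^sub>1..l * \<tau>\<^sub>2} (l * t) = (indicator {\<tau>\<^sub>1..\<tau>\<^sub>2} t :: real)" for t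
    using l by (auto simp: indicator_def)
  moreover have "(c * l) * (I /\<^sub>R \<bar>l\<bar>) = c * I" using l by simp
  ultimately have "has_bochner_integral lebesgue
      (\<lambda>t. (c * l) * (indicator {\<tau>\<^sub>1..\<tau>\<^sub>2} t *\<^sub>R (LINT x|lebesgue. ?f (l * t) x))) (c * I)"
    by (simp only:)
  then have "has_bochner_integral lebesgue
      (\<lambda>t. indicator {\<tau>\<^sub>1..\<tau>\<^sub>2} t *\<^sub>R (LINT x|lebesgue. (c * l) * ?f (l * t) x)) (c * I)"
    by (simp only: integral_mult_right_zero real_scaleR_def mult.left_commute)
  then have 2: "has_bochner_integral (lebesgue_on {\<tau>\<^sub>1..\<tau>\<^sub>2})
      (\<lambda>t. LINT x|lebesgue. inv_op G (\<lambda>x. c * u (l * t) x) x * \<psi>' t x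
          - (c * u (l * t) x) powr m * \<psi> t x) (c * I)"
    unfolding integrand by (simp add: has_bochner_integral_restrict_space)
  have cI: "c * I = (LINT x|lebesgue. inv_op G (\<lambda>x. c * u (l * \<tau>\<^sub>2) x) x * \<psi> \<tau>\<^sub>2 x) -
        (LINT x|lebesgue. inv_op G (\<lambda>x. c * u (l * \<tau>\<^sub>1) x) x * \<psi> \<tau>\<^sub>1 x)"
    using l by (simp add: I_def inv_op_cmult right_diff_distrib mult.assoc)
  show ?thesis
    using id 1 2 l unfolding dual_identity_def cI
    by (auto simp: inv_op_cmult mult.assoc)
qed

lemma weak_dual_solution_scale:
  fixes u :: "real \<Rightarrow> 'a::euclidean_space \<Rightarrow> real"
  assumes u: "weak_dual_solution G m u\<^sub>0 u" and m: "m > 1" and l: "l > 0"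
    and c: "c = l powr (1 / (m - 1))"
  shows "weak_dual_solution G m (\<lambda>x. c * u\<^sub>0 x) (\<lambda>t x. c * u (l * t) x)"
  unfolding weak_dual_solution_def
proof (intro allI impI)
  fix T :: real assume T: "T > 0"
  have c0: "c > 0" using l by (simp add: c)
  have cm: "c powr m = c * l"
  proof -
    have "c powr m = c powr (m - 1) * c powr 1" by (subst powr_add[symmetric]) simp
    moreover have "c powr (m - 1) = l" using l m by (simp add: c powr_powr)
    ultimately show ?thesis using c0 by simp
  qed
  have S: "{0..b} \<times> UNIV \<in> sets (lebesgue :: (real \<times> 'a) measure)" for b :: real
    by (intro sets_completionI_sets) (auto intro!: borel_closed closed_Times)
  have iff: "l * t \<in> {0..l * T} \<longleftrightarrow> t \<in> {0..T}" for t
    using l by (auto simp: zero_le_mult_iff)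
  have "weak_dual_solution_upto G m (l * T) u\<^sub>0 u"
    using u l T unfolding weak_dual_solution_def by simp
  then have u1: "(\<lambda>(t, x). u t x) \<in> borel_measurable (lebesgue_on ({0..l * T} \<times> UNIV))"
    and u2: "AE (t, x) in lebesgue_on ({0..l * T} \<times> UNIV). 0 \<le> u t x"
    and u3: "cont_L1 (l * T) u"
    and u4: "\<And>K. compact K \<Longrightarrow> set_integrable lebesgue ({0<..<l * T} \<times> K) (\<lambda>(t, x). u t x powr m)"
    and u5: "AE t in lebesgue_on {0<..l * T}. AE y in lebesgue. inv_converges G (u t) y"
    and u6: "AE (\<tau>\<^sub>1, \<tau>\<^sub>2) in lebesgue. 0 < \<tau>\<^sub>1 \<and> \<tau>\<^sub>1 \<le> \<tau>\<^sub>2 \<and> \<tau>\<^sub>2 \<le> l * T \<longrightarrow>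
        (\<forall>\<psi> \<psi>'. C1c_Linf \<tau>\<^sub>1 \<tau>\<^sub>2 \<psi> \<psi>' \<longrightarrow> dual_identity G m u \<tau>\<^sub>1 \<tau>\<^sub>2 \<psi> \<psi>')"
    and u7: "AE x in lebesgue. u 0 x = u\<^sub>0 x"
    unfolding weak_dual_solution_upto_def by auto
  note st = scaling_map_time[OF l, where 'a='a]
  show "weak_dual_solution_upto G m T (\<lambda>x. c * u\<^sub>0 x) (\<lambda>t x. c * u (l * t) x)"
    unfolding weak_dual_solution_upto_def
  proof (intro conjI allI impI)
    have "(\<lambda>p. if p \<in> {0..l * T} \<times> UNIV then (case p of (t, x) \<Rightarrow> u t x) else 0)
        \<in> borel_measurable lebesgue"
      using u1 by (subst borel_measurable_if[OF S])
    from measurable_scaling_map[OF st this]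
    have "(\<lambda>p. c * (if l * fst p \<in> {0..l * T} then u (l * fst p) (snd p) else 0))
        \<in> borel_measurable lebesgue"
      by (intro borel_measurable_times) auto
    then have "(\<lambda>p. if p \<in> {0..T} \<times> UNIV then (case p of (t, x) \<Rightarrow> c * u (l * t) x) else 0)
        \<in> borel_measurable lebesgue"
      unfolding iff by (rule measurable_cong[THEN iffD1, rotated]) auto
    then show "(\<lambda>(t, x). c * u (l * t) x) \<in> borel_measurable (lebesgue_on ({0..T} \<times> UNIV))"
      by (subst (asm) borel_measurable_if[OF S])
  next
    have "AE p in lebesgue. p \<in> {0..l * T} \<times> UNIV \<longrightarrow> 0 \<le> u (fst p) (snd p)"
      using u2 S by (subst (asm) AE_restrict_space_iff) (auto simp: case_prod_beta)
    from AE_scaling_map[OF st this]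
    have "AE p in lebesgue. l * fst p \<in> {0..l * T} \<longrightarrow> 0 \<le> u (l * fst p) (snd p)"
      by eventually_elim auto
    then show "AE (t, x) in lebesgue_on ({0..T} \<times> UNIV). 0 \<le> c * u (l * t) x"
      unfolding iff using S c0
      by (subst AE_restrict_space_iff) (auto elim!: eventually_mono simp: case_prod_beta)
  next
    show "cont_L1 T (\<lambda>t x. c * u (l * t) x)"
      unfolding cont_L1_def
    proof (intro conjI ballI)
      fix t assume t: "t \<in> {0..T}"
      show "integrable lebesgue (\<lambda>x. c * u (l * t) x)"
        using u3 t iff[of t] unfolding cont_L1_def by blast
      have "((\<lambda>s. Lp_norm 1 (\<lambda>x. u s x - u (l * t) x)) \<longlongrightarrow> 0) (at (l * t) within {0..l * T})"
        using u3 t iff[of t] unfolding cont_L1_def by blast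
      moreover have "filterlim (\<lambda>s. l * s) (at (l * t) within {0..l * T}) (at t within {0..T})"
        using filterlim_scale_within[OF l, of t 0 T] by simp
      ultimately have "((\<lambda>s. Lp_norm 1 (\<lambda>x. u (l * s) x - u (l * t) x)) \<longlongrightarrow> 0) (at t within {0..T})"
        by (rule filterlim_compose)
      from ennreal_tendsto_cmult[OF _ this, of "ennreal \<bar>c\<bar>"]
      have lim: "((\<lambda>s. ennreal \<bar>c\<bar> * Lp_norm 1 (\<lambda>x. u (l * s) x - u (l * t) x)) \<longlongrightarrow> 0)
          (at t within {0..T})" by simp
      have "\<forall>\<^sub>F s in at t within {0..T}. ennreal \<bar>c\<bar> * Lp_norm 1 (\<lambda>x. u (l * s) x - u (l * t) x)
          = Lp_norm 1 (\<lambda>x. c * u (l * s) x - c * u (l * t) x)"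
        unfolding eventually_at_filter
      proof (intro always_eventually allI impI)
        fix s assume "s \<in> {0..T}"
        then have "integrable lebesgue (u (l * s))" "integrable lebesgue (u (l * t))"
          using u3 t iff unfolding cont_L1_def by blast+
        then show "ennreal \<bar>c\<bar> * Lp_norm 1 (\<lambda>x. u (l * s) x - u (l * t) x)
          = Lp_norm 1 (\<lambda>x. c * u (l * s) x - c * u (l * t) x)"
          unfolding right_diff_distrib[symmetric] by (subst Lp_norm_1_cmult) auto
      qed
      from tendsto_cong[OF this] lim
      show "((\<lambda>s. Lp_norm 1 (\<lambda>x. c * u (l * s) x - c * u (l * t) x)) \<longlongrightarrow> 0) (at t within {0..T})"
        by simp
    qed
  next
    fix K :: "'a set" assume "compact K"
    then have "integrable lebesgue (\<lambda>p. indicat_real ({0<..<l * T} \<times> K) p *\<^sub>R (u (fst p) (snd p) powr m))"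
      using u4 unfolding set_integrable_def by (simp add: case_prod_beta)
    from integrable_scaling_map[OF st this]
    have "integrable lebesgue (\<lambda>p. c powr m *
        (indicat_real ({0<..<l * T} \<times> K) (l * fst p, snd p) * (u (l * fst p) (snd p) powr m)))"
      by simp
    moreover have "c powr m * (indicat_real ({0<..<l * T} \<times> K) (l * fst p, snd p) * (u (l * fst p) (snd p) powr m))
      = indicat_real ({0<..<T} \<times> K) p *\<^sub>R (case p of (t, x) \<Rightarrow> (c * u (l * t) x) powr m)" for p
      using l by (cases p) (auto simp: indicator_def powr_mult zero_less_mult_iff)
    ultimately show "set_integrable lebesgue ({0<..<T} \<times> K) (\<lambda>(t, x). (c * u (l * t) x) powr m)"
      unfolding set_integrable_def by simp
  next
    have "AE t in lebesgue. t \<in> {0<..l * T} \<longrightarrow> (AE y in lebesgue. inv_converges G (u t) y)"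
      using u5 by (simp add: AE_restrict_space_iff)
    from AE_scaling_map[OF scaling_map_affine[of l "0::real"] this] l
    have "AE t in lebesgue. l * t \<in> {0<..l * T} \<longrightarrow> (AE y in lebesgue. inv_converges G (u (l * t)) y)"
      by simp
    then have "AE t in lebesgue. t \<in> {0<..T} \<longrightarrow>
        (AE y in lebesgue. inv_converges G (\<lambda>x. c * u (l * t) x) y)"
    proof eventually_elim
      fix t assume *: "l * t \<in> {0<..l * T} \<longrightarrow> (AE y in lebesgue. inv_converges G (u (l * t)) y)"
      show "t \<in> {0<..T} \<longrightarrow> (AE y in lebesgue. inv_converges G (\<lambda>x. c * u (l * t) x) y)"
      proof
        assume "t \<in> {0<..T}"
        then have "AE y in lebesgue. inv_converges G (u (l * t)) y" using * l by auto
        then show "AE y in lebesgue. inv_converges G (\<lambda>x. c * u (l * t) x) y"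
          by eventually_elim (simp add: inv_converges_def mult.left_commute[of _ c])
      qed
    qed
    then show "AE t in lebesgue_on {0<..T}. AE y in lebesgue. inv_converges G (\<lambda>x. c * u (l * t) x) y"
      by (simp add: AE_restrict_space_iff)
  next
    have u6': "AE p in lebesgue. 0 < fst p \<and> fst p \<le> snd p \<and> snd p \<le> l * T \<longrightarrow>
        (\<forall>\<psi> \<psi>'. C1c_Linf (fst p) (snd p) \<psi> \<psi>' \<longrightarrow> dual_identity G m u (fst p) (snd p) \<psi> \<psi>')"
      using u6 by (simp add: case_prod_beta)
    have "l \<noteq> 0" using l by simp
    from AE_scaling_map[OF scaling_map_affine[OF this, of "0 :: real \<times> real"] u6']
    show "AE (\<tau>\<^sub>1, \<tau>\<^sub>2) in lebesgue. 0 < \<tau>\<^sub>1 \<and> \<tau>\<^sub>1 \<le> \<tau>\<^sub>2 \<and> \<tau>\<^sub>2 \<le> T \<longrightarrow>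
        (\<forall>\<psi> \<psi>'. C1c_Linf \<tau>\<^sub>1 \<tau>\<^sub>2 \<psi> \<psi>' \<longrightarrow>
          dual_identity G m (\<lambda>t x. c * u (l * t) x) \<tau>\<^sub>1 \<tau>\<^sub>2 \<psi> \<psi>')"
    proof (eventually_elim, clarify)
      fix \<tau>\<^sub>1 \<tau>\<^sub>2 :: real and \<psi> \<psi>' :: "real \<Rightarrow> 'a \<Rightarrow> real"
      let ?p = "0 + l *\<^sub>R (\<tau>\<^sub>1, \<tau>\<^sub>2)"
      assume *: "0 < fst ?p \<and> fst ?p \<le> snd ?p \<and> snd ?p \<le> l * T \<longrightarrow>
        (\<forall>\<psi> \<psi>'. C1c_Linf (fst ?p) (snd ?p) \<psi> \<psi>' \<longrightarrow> dual_identity G m u (fst ?p) (snd ?p) \<psi> \<psi>')"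
        and \<tau>: "0 < \<tau>\<^sub>1" "\<tau>\<^sub>1 \<le> \<tau>\<^sub>2" "\<tau>\<^sub>2 \<le> T" and \<psi>: "C1c_Linf \<tau>\<^sub>1 \<tau>\<^sub>2 \<psi> \<psi>'"
      show "dual_identity G m (\<lambda>t x. c * u (l * t) x) \<tau>\<^sub>1 \<tau>\<^sub>2 \<psi> \<psi>'"
        using * \<tau> l C1c_Linf_scale[OF \<psi> l] by (intro dual_identity_scale l cm) auto
    qed
  next
    show "AE x in lebesgue. c * u (l * 0) x = c * u\<^sub>0 x" using u7 by eventually_elim simp
  qed
qed

section \<open>Monotonicity in time\<close>

lemma AE_lebesgue_between:
  assumes "AE s in lebesgue. Q (s::real)" "a < b"
  shows "\<exists>s. a < s \<and> s < b \<and> Q s"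
proof (rule ccontr)
  assume neg: "\<not> ?thesis"
  have "AE s in lebesgue. s \<notin> {a<..<b}"
    using assms(1) by eventually_elim (use neg in auto)
  then have "{a<..<b} \<in> null_sets lebesgue"
    by (subst (asm) AE_iff_null_sets[symmetric]) auto
  then have "emeasure lebesgue {a<..<b} = 0" by blast
  then show False using assms(2) by simp
qed

text \<open>
  Comparison with the scaled solution gives the inequality for almost every \<open>t\<close> only. It extends to
  every \<open>t > 0\<close> because both sides are continuous in time with values in \<open>L\<^sup>1\<close>.
\<close>

lemma comparison_time_monotone:
  fixes u :: "real \<Rightarrow> 'a::euclidean_space \<Rightarrow> real"
  assumes u: "weak_dual_solution G m u\<^sub>0 u" and u0: "initial_datum u\<^sub>0"
    and cp: "comparison_principle G m" and m: "m > 1" and l: "l \<ge> 1" and t: "t > 0"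
  shows "AE x in lebesgue. u t x \<le> l powr (1 / (m - 1)) * u (l * t) x"
proof -
  define c where "c = l powr (1 / (m - 1))"
  have c1: "c \<ge> 1" unfolding c_def using l m by (simp add: ge_one_powr_ge_zero)
  have v: "weak_dual_solution G m (\<lambda>x. c * u\<^sub>0 x) (\<lambda>t x. c * u (l * t) x)"
    using l by (intro weak_dual_solution_scale[OF u m _ c_def]) auto
  have v0: "initial_datum (\<lambda>x. c * u\<^sub>0 x)"
    using u0 c1 by (auto simp: initial_datum_def elim!: eventually_mono)
  have le0: "AE x in lebesgue. u\<^sub>0 x \<le> c * u\<^sub>0 x"
    using u0 mult_right_mono[OF c1] by (fastforce simp: initial_datum_def elim!: eventually_mono)
  have "AE p in lebesgue. 0 < fst p \<longrightarrow> u (fst p) (snd p) \<le> c * u (l * fst p) (snd p)"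
    using cp[unfolded comparison_principle_def, rule_format, OF u0 v0 u v le0]
    by (simp add: case_prod_beta)
  from AE_lebesgue_prodD[OF this]
  have ae: "AE s in lebesgue. AE x in lebesgue. 0 < s \<longrightarrow> u s x \<le> c * u (l * s) x" by simp
  define T where "T = t + 1"
  have T: "T > 0" "t \<in> {0..T}" using t by (auto simp: T_def)
  have cont: "cont_L1 T u" and contv: "cont_L1 T (\<lambda>t x. c * u (l * t) x)"
    using u v T unfolding weak_dual_solution_def weak_dual_solution_upto_def by blast+
  have int: "integrable lebesgue (u s)" "integrable lebesgue (\<lambda>x. c * u (l * s) x)"
    if "s \<in> {0..T}" for s
    using cont contv that unfolding cont_L1_def by blast+
  \<comment> \<open>The violation \<open>\<Phi>\<close> of the inequality at \<open>t\<close> is at most \<open>R s\<close> for every good time \<open>s\<close>.\<close>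
  define \<Phi> where "\<Phi> = (\<integral>\<^sup>+x. ennreal (u t x - c * u (l * t) x) \<partial>lebesgue)"
  define R where "R = (\<lambda>s. Lp_norm 1 (\<lambda>x. u s x - u t x)
      + Lp_norm 1 (\<lambda>x. c * u (l * s) x - c * u (l * t) x))"
  have "(R \<longlongrightarrow> 0 + 0) (at t within {0..T})"
    unfolding R_def using cont contv T(2) unfolding cont_L1_def by (intro tendsto_add) blast+
  then have R: "(R \<longlongrightarrow> 0) (at t within {0..T})" by simp
  have \<Phi>R: "\<Phi> \<le> R s" if s: "s \<in> {0..T}" "AE x in lebesgue. u s x \<le> c * u (l * s) x" for s
  proof -
    have [measurable]: "u s \<in> borel_measurable lebesgue" "u t \<in> borel_measurable lebesgue"
      "(\<lambda>x. c * u (l * s) x) \<in> borel_measurable lebesgue"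
      "(\<lambda>x. c * u (l * t) x) \<in> borel_measurable lebesgue"
      using int[OF s(1)] int[OF T(2)] by blast+
    have "\<Phi> \<le> (\<integral>\<^sup>+x. ennreal \<bar>u s x - u t x\<bar> + ennreal \<bar>c * u (l * s) x - c * u (l * t) x\<bar> \<partial>lebesgue)"
      unfolding \<Phi>_def
      by (rule nn_integral_mono_AE, use s(2) in eventually_elim)
        (auto simp: ennreal_plus[symmetric] simp del: ennreal_plus intro!: ennreal_leI)
    also have "\<dots> = R s" unfolding R_def Lp_norm_1
      by (intro nn_integral_add) measurable
    finally show ?thesis .
  qed
  have "\<Phi> = 0"
  proof (rule ccontr)
    assume "\<Phi> \<noteq> 0"
    then have "\<forall>\<^sub>F s in at t within {0..T}. R s < \<Phi>"
      using R by (intro order_tendstoD(2)) (auto simp: zero_less_iff_neq_zero)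
    then obtain d where d: "d > 0"
      "\<And>s. s \<in> {0..T} \<Longrightarrow> s \<noteq> t \<Longrightarrow> dist s t < d \<Longrightarrow> R s < \<Phi>"
      unfolding eventually_at by auto
    obtain s where s: "t < s" "s < t + min d 1" "AE x in lebesgue. 0 < s \<longrightarrow> u s x \<le> c * u (l * s) x"
      using AE_lebesgue_between[OF ae, of t "t + min d 1"] d(1) by auto
    have sT: "s \<in> {0..T}" using s t by (auto simp: T_def)
    have "R s < \<Phi>" using s by (intro d sT) (auto simp: dist_real_def)
    moreover have "\<Phi> \<le> R s" using s t by (intro \<Phi>R sT) auto
    ultimately show False by simp
  qed
  moreover have "(\<lambda>x. ennreal (u t x - c * u (l * t) x)) \<in> borel_measurable lebesgue"
    using int[OF T(2)] by (intro measurable_compose[OF _ measurable_ennreal] borel_measurable_diff) blast+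
  ultimately have "AE x in lebesgue. ennreal (u t x - c * u (l * t) x) = 0"
    unfolding \<Phi>_def by (simp add: nn_integral_0_iff_AE)
  then show ?thesis unfolding c_def by eventually_elim (auto simp: ennreal_eq_0_iff)
qed

lemma weak_dual_solution_nonneg:
  fixes u :: "real \<Rightarrow> 'a::euclidean_space \<Rightarrow> real"
  assumes u: "weak_dual_solution G m u\<^sub>0 u"
  shows "AE t in lebesgue. 0 < t \<longrightarrow> (AE x in lebesgue. 0 \<le> u t x)"
proof -
  have "AE t in lebesgue. AE x in lebesgue. t \<in> {0..real (Suc n)} \<longrightarrow> 0 \<le> u t x" for n
  proof -
    have S: "{0..real (Suc n)} \<times> UNIV \<in> sets (lebesgue :: (real \<times> 'a) measure)"
      by (intro sets_completionI_sets) (auto intro!: borel_closed closed_Times)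
    have "AE p in lebesgue_on ({0..real (Suc n)} \<times> UNIV). 0 \<le> u (fst p) (snd p)"
      using u unfolding weak_dual_solution_def weak_dual_solution_upto_def
      by (simp add: case_prod_beta del: of_nat_Suc)
    then have "AE p in lebesgue. fst p \<in> {0..real (Suc n)} \<longrightarrow> 0 \<le> u (fst p) (snd p)"
      using S by (subst (asm) AE_restrict_space_iff) (auto elim!: eventually_mono)
    from AE_lebesgue_prodD[OF this] show ?thesis by simp
  qed
  then have "AE t in lebesgue. \<forall>n. AE x in lebesgue. t \<in> {0..real (Suc n)} \<longrightarrow> 0 \<le> u t x"
    by (subst AE_all_countable) auto
  then show ?thesis
  proof (eventually_elim, intro impI)
    fix t :: real assume *: "\<forall>n. AE x in lebesgue. t \<in> {0..real (Suc n)} \<longrightarrow> 0 \<le> u t x" and "0 < t"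
    obtain n where "t < real n" using reals_Archimedean2 by blast
    with *[rule_format, of n] \<open>0 < t\<close> show "AE x in lebesgue. 0 \<le> u t x" by simp
  qed
qed

section \<open>The weak formulation tested with indicator functions\<close>

lemma C1c_Linf_const:
  fixes E :: "'a::euclidean_space set"
  assumes "E \<in> sets lebesgue" "bounded E"
  shows "C1c_Linf a b (\<lambda>t. indicat_real E) (\<lambda>t x. 0)"
proof -
  have "in_Lp \<infinity> (\<lambda>x::'a. 0)"
    by (auto simp: in_Lp_def Lp_norm_def intro!: le_less_trans[OF esssup_I, of _ _ 0])
  moreover have "in_Lp \<infinity> (indicat_real E)"
    using assms unfolding in_Lp_def Lp_norm_def
    by (auto intro!: le_less_trans[OF esssup_I, of _ _ 1] simp: indicator_def)
  moreover have "Lp_norm \<infinity> (\<lambda>x::'a. 0) = 0"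
    using esssup_I[of "\<lambda>x::'a. 0 :: ennreal" lebesgue 0] by (auto simp: Lp_norm_def intro: antisym)
  moreover have "x \<notin> closure E \<longrightarrow> indicat_real E x = 0" for x
    using closure_subset[of E] by (auto simp: indicator_def)
  ultimately show ?thesis
    unfolding C1c_Linf_def using assms by (auto intro!: exI[of _ "closure E"])
qed

text \<open>
  The final time may be any \<open>\<tau>\<^sub>2 \<ge> 2\<tau>\<close> because only the part \<open>[\<tau>, 2\<tau>]\<close> of the time integral is kept.
  The value \<open>2\<tau>\<close> itself need not be admissible: the weak formulation holds only for almost every pair
  of times.
\<close>

lemma local_integral_estimate:
  fixes u :: "real \<Rightarrow> 'a::euclidean_space \<Rightarrow> real"
  assumes id: "dual_identity G m u \<tau> \<tau>\<^sub>2 (\<lambda>t. indicat_real E) (\<lambda>t x. 0)"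
    and G: "G 0 \<in> borel_measurable lebesgue" "AE x in lebesgue. 0 \<le> G 0 x"
    and \<tau>: "0 < \<tau>" "2 * \<tau> \<le> \<tau>\<^sub>2" and E: "E \<in> sets lebesgue" and m: "m > 1"
    and meas: "u \<tau> \<in> borel_measurable lebesgue"
    and nonneg: "AE x in lebesgue. 0 \<le> u \<tau> x" "AE x in lebesgue. 0 \<le> u \<tau>\<^sub>2 x"
    and mono: "\<And>l. l \<ge> 1 \<Longrightarrow> AE x in lebesgue. u \<tau> x \<le> l powr (1 / (m - 1)) * u (l * \<tau>) x"
  shows "integrable lebesgue (\<lambda>x. u \<tau> x powr m * indicat_real E x)"
    and "integrable lebesgue (\<lambda>x. inv_op G (u \<tau>) x * indicat_real E x)"
    and "(LINT x|lebesgue. u \<tau> x powr m * indicat_real E x)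
      \<le> 2 powr (m / (m - 1)) / \<tau> * (LINT x|lebesgue. inv_op G (u \<tau>) x * indicat_real E x)"
proof -
  define a where "a = (LINT x|lebesgue. inv_op G (u \<tau>) x * indicat_real E x)"
  define b where "b = (LINT x|lebesgue. inv_op G (u \<tau>\<^sub>2) x * indicat_real E x)"
  define J where "J = (\<lambda>t. LINT x|lebesgue. u t x powr m * indicat_real E x)"
  define I where "I = (LINT x|lebesgue. u \<tau> x powr m * indicat_real E x)"
  define k where "k = 2 powr (m / (m - 1))"
  have k0: "k > 0" by (simp add: k_def)
  show "integrable lebesgue (\<lambda>x. inv_op G (u \<tau>) x * indicat_real E x)"
    using id unfolding dual_identity_def by blast
  have intu: "AE t in lebesgue. t \<in> {\<tau>..\<tau>\<^sub>2} \<longrightarrow>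
      integrable lebesgue (\<lambda>x. u t x powr m * indicat_real E x)"
    using id unfolding dual_identity_def by (simp add: AE_restrict_space_iff)
  have "has_bochner_integral (lebesgue_on {\<tau>..\<tau>\<^sub>2}) (\<lambda>t. - J t) (b - a)"
    using id unfolding dual_identity_def J_def a_def b_def by simp
  from has_bochner_integral_minus[OF this]
  have "has_bochner_integral lebesgue (\<lambda>t. indicat_real {\<tau>..\<tau>\<^sub>2} t *\<^sub>R J t) (a - b)"
    by (simp add: has_bochner_integral_restrict_space)
  then have J: "integrable lebesgue (\<lambda>t. indicat_real {\<tau>..\<tau>\<^sub>2} t * J t)"
    "(LINT t|lebesgue. indicat_real {\<tau>..\<tau>\<^sub>2} t * J t) = a - b"
    by (auto simp: has_bochner_integral_iff)
  have inv2: "0 \<le> inv_op G (u \<tau>\<^sub>2) y" for y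
  proof -
    have "AE x in lebesgue. 0 \<le> G 0 (x - y)"
      using AE_scaling_map[OF scaling_map_affine[of 1 "- y"] G(2)] by simp
    with nonneg(2) have "AE x in lebesgue. 0 \<le> G 0 (x - y) * u \<tau>\<^sub>2 x"
      by eventually_elim auto
    then show ?thesis unfolding inv_op_def by (rule integral_nonneg_AE)
  qed
  have b0: "0 \<le> b" unfolding b_def by (intro integral_nonneg_AE) (auto simp: inv2)
  have J0: "0 \<le> J t" for t unfolding J_def by (intro integral_nonneg_AE) auto
  have pw: "AE x in lebesgue. u \<tau> x powr m * indicat_real E x \<le> k * (u t x powr m * indicat_real E x)"
    if t: "t \<in> {\<tau>..2 * \<tau>}" for t
  proof -
    have t1: "t / \<tau> \<ge> 1" "t / \<tau> \<le> 2" using t \<tau> by (auto simp: field_simps)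
    have "AE x in lebesgue. u \<tau> x \<le> (t / \<tau>) powr (1 / (m - 1)) * u t x"
      using mono[OF t1(1)] \<tau> by simp
    with nonneg(1) show ?thesis
    proof eventually_elim
      fix x assume *: "0 \<le> u \<tau> x" "u \<tau> x \<le> (t / \<tau>) powr (1 / (m - 1)) * u t x"
      have "u \<tau> x powr m \<le> ((t / \<tau>) powr (1 / (m - 1)) * u t x) powr m"
        using * m by (intro powr_mono2) auto
      also have "\<dots> = (t / \<tau>) powr (m / (m - 1)) * u t x powr m"
        by (simp add: powr_mult powr_powr)
      also have "\<dots> \<le> k * u t x powr m"
        unfolding k_def using t1 m by (intro mult_right_mono powr_mono2) auto
      finally show "u \<tau> x powr m * indicat_real E x \<le> k * (u t x powr m * indicat_real E x)"
        by (auto simp: indicator_def)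
    qed
  qed
  have mI: "(\<lambda>x. u \<tau> x powr m * indicat_real E x) \<in> borel_measurable lebesgue"
    using meas E by measurable
  \<comment> \<open>One good time suffices: there \<open>u t powr m\<close> is integrable over \<open>E\<close> and dominates \<open>u \<tau> powr m\<close> up to a constant.\<close>
  obtain t where "\<tau> < t" "t < 2 * \<tau>" and tint: "integrable lebesgue (\<lambda>x. u t x powr m * indicat_real E x)"
    using AE_lebesgue_between[OF intu, of \<tau> "2 * \<tau>"] \<tau> by auto
  then show intI: "integrable lebesgue (\<lambda>x. u \<tau> x powr m * indicat_real E x)"
  proof -
    have "integrable lebesgue (\<lambda>x. k * (u t x powr m * indicat_real E x))" using tint by simp
    then show ?thesis
    proof (rule Bochner_Integration.integrable_bound[OF _ mI])
      show "AE x in lebesgue. norm (u \<tau> x powr m * indicat_real E x)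
          \<le> norm (k * (u t x powr m * indicat_real E x))"
        using pw[of t] \<open>\<tau> < t\<close> \<open>t < 2 * \<tau>\<close> k0 by (auto simp: abs_mult elim!: eventually_mono)
    qed
  qed
  have low: "AE t in lebesgue. indicat_real {\<tau>..2 * \<tau>} t * (I / k) \<le> indicat_real {\<tau>..\<tau>\<^sub>2} t * J t"
    using intu
  proof eventually_elim
    fix t assume *: "t \<in> {\<tau>..\<tau>\<^sub>2} \<longrightarrow> integrable lebesgue (\<lambda>x. u t x powr m * indicat_real E x)"
    show "indicat_real {\<tau>..2 * \<tau>} t * (I / k) \<le> indicat_real {\<tau>..\<tau>\<^sub>2} t * J t"
    proof (cases "t \<in> {\<tau>..2 * \<tau>}")
      case True
      have "I \<le> (LINT x|lebesgue. k * (u t x powr m * indicat_real E x))"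
        unfolding I_def using * True \<tau> by (intro integral_mono_AE intI pw) auto
      also have "\<dots> = k * J t" unfolding J_def by simp
      finally have "I / k \<le> J t" using k0 by (simp add: field_simps)
      then show ?thesis using True \<tau> by (simp add: indicator_def)
    qed (use J0 in \<open>auto simp: indicator_def\<close>)
  qed
  have "\<tau> * (I / k) = (LINT t|lebesgue. indicat_real {\<tau>..2 * \<tau>} t * (I / k))"
    using \<tau> by simp
  also have "\<dots> \<le> (LINT t|lebesgue. indicat_real {\<tau>..\<tau>\<^sub>2} t * J t)"
  proof (rule integral_mono_AE[OF _ J(1) low])
    show "integrable lebesgue (\<lambda>t. indicat_real {\<tau>..2 * \<tau>} t * (I / k))"
      using \<tau> by (intro integrable_mult_left integrable_real_indicator) auto
  qed
  also have "\<dots> \<le> a" using J(2) b0 by simp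
  finally have "\<tau> * (I / k) \<le> a" .
  then show "I \<le> k / \<tau> * a" using k0 \<tau> by (simp add: field_simps)
qed

lemma AE_le_if_integral_le:
  fixes f h :: "'a::euclidean_space \<Rightarrow> real"
  assumes int: "\<And>E. E \<in> sets lebesgue \<Longrightarrow> bounded E \<Longrightarrow> integrable lebesgue (\<lambda>x. f x * indicat_real E x)"
      "\<And>E. E \<in> sets lebesgue \<Longrightarrow> bounded E \<Longrightarrow> integrable lebesgue (\<lambda>x. h x * indicat_real E x)"
    and le: "\<And>E. E \<in> sets lebesgue \<Longrightarrow> bounded E \<Longrightarrow>
      (LINT x|lebesgue. f x * indicat_real E x) \<le> (LINT x|lebesgue. h x * indicat_real E x)"
  shows "AE x in lebesgue. f x \<le> h x"
proof -
  have "AE x in lebesgue. x \<in> ball 0 (real n) \<longrightarrow> f x \<le> h x" for n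
  proof -
    let ?B = "ball (0::'a) (real n)"
    have B: "?B \<in> sets lebesgue" "bounded ?B" by auto
    define E where "E = {x \<in> space lebesgue. h x * indicat_real ?B x < f x * indicat_real ?B x}"
    have Es: "E \<in> sets lebesgue"
      unfolding E_def using int(1)[OF B] int(2)[OF B] by (intro borel_measurable_less) auto
    have EB: "E \<subseteq> ?B" by (auto simp: E_def indicator_def split: if_splits)
    then have Eb: "bounded E" using bounded_ball bounded_subset by blast
    have pos: "f x * indicat_real E x - h x * indicat_real E x \<ge> 0" for x
      using EB by (auto simp: E_def indicator_def)
    have i: "integrable lebesgue (\<lambda>x. f x * indicat_real E x - h x * indicat_real E x)"
      using int[OF Es Eb] by simp
    have "(LINT x|lebesgue. f x * indicat_real E x - h x * indicat_real E x) \<le> 0"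
      using int[OF Es Eb] le[OF Es Eb] by simp
    moreover have "(LINT x|lebesgue. f x * indicat_real E x - h x * indicat_real E x) \<ge> 0"
      using pos by (intro integral_nonneg_AE) auto
    ultimately have "AE x in lebesgue. f x * indicat_real E x - h x * indicat_real E x = 0"
      using integral_nonneg_eq_0_iff_AE[OF i] pos by simp
    then show ?thesis
    proof eventually_elim
      fix x assume eq: "f x * indicat_real E x - h x * indicat_real E x = 0"
      show "x \<in> ?B \<longrightarrow> f x \<le> h x"
      proof (rule impI, rule ccontr)
        assume "x \<in> ?B" "\<not> f x \<le> h x"
        then have "x \<in> E" by (simp add: E_def)
        with eq \<open>\<not> f x \<le> h x\<close> show False by simp
      qed
    qed
  qed
  then have "AE x in lebesgue. \<forall>n. x \<in> ball 0 (real n) \<longrightarrow> f x \<le> h x"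
    by (subst AE_all_countable) auto
  then show ?thesis
  proof eventually_elim
    fix x assume *: "\<forall>n. x \<in> ball 0 (real n) \<longrightarrow> f x \<le> h x"
    obtain n where "norm x < real n" using reals_Archimedean2 by blast
    then show "f x \<le> h x" using * by auto
  qed
qed

lemma fundamental_upper_bound:
  fixes u :: "real \<Rightarrow> 'a::euclidean_space \<Rightarrow> real"
  assumes u: "weak_dual_solution G m u\<^sub>0 u" and u0: "initial_datum u\<^sub>0"
    and cp: "comparison_principle G m" and m: "m > 1"
    and G: "G 0 \<in> borel_measurable lebesgue" "AE x in lebesgue. 0 \<le> G 0 x"
  shows "AE \<tau> in lebesgue. 0 < \<tau> \<longrightarrow>
    (AE y in lebesgue. u \<tau> y powr m \<le> 2 powr (m / (m - 1)) / \<tau> * inv_op G (u \<tau>) y)"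
proof -
  let ?Q = "\<lambda>\<tau>\<^sub>1 \<tau>\<^sub>2. \<forall>\<psi> \<psi>'. C1c_Linf \<tau>\<^sub>1 \<tau>\<^sub>2 \<psi> \<psi>' \<longrightarrow> dual_identity G m u \<tau>\<^sub>1 \<tau>\<^sub>2 \<psi> \<psi>'"
  \<comment> \<open>The exceptional set of pairs depends on the time horizon, which runs through the positive integers.\<close>
  have "AE \<tau>\<^sub>1 in lebesgue. AE \<tau>\<^sub>2 in lebesgue.
      0 < \<tau>\<^sub>1 \<and> \<tau>\<^sub>1 \<le> \<tau>\<^sub>2 \<and> \<tau>\<^sub>2 \<le> real (Suc n) \<longrightarrow> ?Q \<tau>\<^sub>1 \<tau>\<^sub>2" for n
  proof -
    have "AE p in lebesgue. 0 < fst p \<and> fst p \<le> snd p \<and> snd p \<le> real (Suc n) \<longrightarrow>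
        ?Q (fst p) (snd p)"
      using u unfolding weak_dual_solution_def weak_dual_solution_upto_def
      by (simp add: case_prod_beta del: of_nat_Suc)
    from AE_lebesgue_prodD[OF this] show ?thesis by simp
  qed
  then have "AE \<tau>\<^sub>1 in lebesgue. \<forall>n. AE \<tau>\<^sub>2 in lebesgue.
      0 < \<tau>\<^sub>1 \<and> \<tau>\<^sub>1 \<le> \<tau>\<^sub>2 \<and> \<tau>\<^sub>2 \<le> real (Suc n) \<longrightarrow> ?Q \<tau>\<^sub>1 \<tau>\<^sub>2"
    by (subst AE_all_countable) auto
  with weak_dual_solution_nonneg[OF u] show ?thesis
  proof (eventually_elim, intro impI)
    fix \<tau> :: real
    assume nn: "0 < \<tau> \<longrightarrow> (AE x in lebesgue. 0 \<le> u \<tau> x)"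
      and *: "\<forall>n. AE \<tau>\<^sub>2 in lebesgue. 0 < \<tau> \<and> \<tau> \<le> \<tau>\<^sub>2 \<and> \<tau>\<^sub>2 \<le> real (Suc n) \<longrightarrow> ?Q \<tau> \<tau>\<^sub>2"
      and \<tau>: "0 < \<tau>"
    obtain n where n: "3 * \<tau> < real n" using reals_Archimedean2 by blast
    from *[rule_format, of n] weak_dual_solution_nonneg[OF u]
    have "AE \<tau>\<^sub>2 in lebesgue. (0 < \<tau> \<and> \<tau> \<le> \<tau>\<^sub>2 \<and> \<tau>\<^sub>2 \<le> real (Suc n) \<longrightarrow> ?Q \<tau> \<tau>\<^sub>2) \<and>
        (0 < \<tau>\<^sub>2 \<longrightarrow> (AE x in lebesgue. 0 \<le> u \<tau>\<^sub>2 x))"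
      by (rule AE_conjI)
    from AE_lebesgue_between[OF this, of "2 * \<tau>" "3 * \<tau>"] \<tau> n
    obtain \<tau>\<^sub>2 where \<tau>\<^sub>2: "2 * \<tau> < \<tau>\<^sub>2" "?Q \<tau> \<tau>\<^sub>2" "AE x in lebesgue. 0 \<le> u \<tau>\<^sub>2 x"
      by auto
    have "cont_L1 \<tau> u"
      using u \<tau> unfolding weak_dual_solution_def weak_dual_solution_upto_def by blast
    then have "integrable lebesgue (u \<tau>)" using \<tau> unfolding cont_L1_def by auto
    then have meas: "u \<tau> \<in> borel_measurable lebesgue" by blast
    have \<tau>2: "2 * \<tau> \<le> \<tau>\<^sub>2" using \<tau>\<^sub>2 by simp
    note est = local_integral_estimate[OF \<tau>\<^sub>2(2)[rule_format, OF C1c_Linf_const] G \<tau> \<tau>2 _ m meas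
        nn[rule_format, OF \<tau>] \<tau>\<^sub>2(3) comparison_time_monotone[OF u u0 cp m _ \<tau>]]
    show "AE y in lebesgue. u \<tau> y powr m \<le> 2 powr (m / (m - 1)) / \<tau> * inv_op G (u \<tau>) y"
      by (rule AE_le_if_integral_le)
        (use est in \<open>auto simp: mult.assoc simp del: times_divide_eq_left\<close>)
  qed
qed

section \<open>The smoothing effect\<close>

theorem theorem3p7:
  fixes m C\<^sub>1 :: real
    and D :: "(real ^ 'n \<Rightarrow> real) set"
    and A :: "(real ^ 'n \<Rightarrow> real) \<Rightarrow> (real ^ 'n \<Rightarrow> real)"
    and G :: "real ^ 'n \<Rightarrow> real ^ 'n \<Rightarrow> real"
    and u\<^sub>0 :: "real ^ 'n \<Rightarrow> real"
    and u :: "real \<Rightarrow> real ^ 'n \<Rightarrow> real"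
  assumes "CARD('n) \<ge> 3"
    and "m > 1"
    and "admissible_operator D A"
    and "green_function D A G"
    and "comparison_principle G m"
    and "Lp_decay G m"
    and "initial_datum u\<^sub>0"
    and "weak_dual_solution G m u\<^sub>0 u"
    and "C\<^sub>1 > 0"
    and "\<And>x0. Lp_norm 1 (G x0) = Lp_norm 1 (G 0)"
    and "Lp_norm 1 (G 0) \<le> ennreal C\<^sub>1"
  shows "AE t in lebesgue. t > 0 \<longrightarrow>
    Lp_norm \<infinity> (u t) \<le> ennreal ((2 powr (m / (m - 1)) * C\<^sub>1) powr (1 / (m - 1)) * t powr (- 1 / (m - 1)))"
proof -
  note m = \<open>m > 1\<close>
  note u = \<open>weak_dual_solution G m u\<^sub>0 u\<close>
  have loc: "L1_loc (G 0)" and nonneg: "AE x in lebesgue. 0 \<le> G 0 x"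
    using \<open>green_function D A G\<close> unfolding green_function_def by (blast, force)
  have meas: "G 0 \<in> borel_measurable lebesgue"
    using loc by (rule L1_loc_measurable)
  have norm: "(\<integral>\<^sup>+x. ennreal (G 0 x) \<partial>lebesgue) \<le> ennreal C\<^sub>1"
    by (rule order_trans[OF nn_integral_mono \<open>Lp_norm 1 (G 0) \<le> ennreal C\<^sub>1\<close>[unfolded Lp_norm_1]])
      (auto intro: ennreal_leI)
  from fundamental_upper_bound[OF u \<open>initial_datum u\<^sub>0\<close> \<open>comparison_principle G m\<close> m meas nonneg]
    weak_dual_solution_nonneg[OF u]
  show ?thesis
  proof (eventually_elim, intro impI)
    fix t :: real
    assume *: "0 < t \<longrightarrow>
        (AE y in lebesgue. u t y powr m \<le> 2 powr (m / (m - 1)) / t * inv_op G (u t) y)"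
      and nn: "0 < t \<longrightarrow> (AE x in lebesgue. 0 \<le> u t x)" and t: "0 < t"
    define B where "B = (2 powr (m / (m - 1)) * C\<^sub>1) powr (1 / (m - 1)) * t powr (- 1 / (m - 1))"
    have "cont_L1 t u"
      using u t unfolding weak_dual_solution_def weak_dual_solution_upto_def by blast
    then have int: "integrable lebesgue (u t)" using t unfolding cont_L1_def by auto
    have B0: "B > 0" using t \<open>C\<^sub>1 > 0\<close> by (simp add: B_def)
    have "B powr (m - 1) = 2 powr (m / (m - 1)) * C\<^sub>1 * t powr (- 1)"
      using m t \<open>C\<^sub>1 > 0\<close> by (simp add: B_def powr_mult powr_powr)
    then have B: "B powr (m - 1) = (2 powr (m / (m - 1)) / t) * C\<^sub>1"
      using t by (simp add: powr_minus_divide)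
    have "AE x in lebesgue. u t x \<le> B"
      using * nn t \<open>C\<^sub>1 > 0\<close> B0 m B unfolding inv_op_def
      by (intro convolution_inequality_bound[OF meas nonneg norm int, where K = "2 powr (m / (m - 1)) / t"]) auto
    with nn t have "AE x in lebesgue. ennreal \<bar>u t x\<bar> \<le> ennreal B"
      by (auto elim!: eventually_elim2 intro!: ennreal_leI)
    then show "Lp_norm \<infinity> (u t) \<le> ennreal B"
      unfolding Lp_norm_def using int by (auto intro!: esssup_I)
  qed
qed

end
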